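(* Let $B$ be a finite Blaschke product of degree $n$ whose Blaschke curve is an ellipse. Then for each factor $k>1$ of $n$, there exist a Blaschke product $C$ of degree $k$ and a Blaschke product $D$ of degree $n/k$ such that $B=C\circ D$.
   Context: A finite Blaschke product of degree $d$ is $B(z)=\gamma\prod_{j=1}^d \frac{z-a_j}{1-\overline{a_j}z}$ with $a_j\in\mathbb{D}$ and $|\gamma|=1$. The Blaschke curve of $B$ is the curve in $\mathbb{D}$ inscribed in all the convex polygons whose vertices are the solutions $z\in\mathbb{T}$ of $B(z)=\lambda$, as $\lambda$ ranges over the unit circle $\mathbb{T}$; each point of the curve is a point of tangency of a side of such a polygon. *)

theory Defs
  imports "HOL-Analysis.Analysis"
begin

definition blaschke :: "nat \<Rightarrow> (complex \<Rightarrow> complex) \<Rightarrow> bool" where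
  "blaschke d B \<longleftrightarrow>
     (\<exists>(\<gamma>::complex) (a::nat \<Rightarrow> complex).
        norm \<gamma> = 1 \<and> (\<forall>j<d. norm (a j) < 1) \<and>
        (\<forall>z. B z = \<gamma> * (\<Prod>j<d. (z - a j) / (1 - cnj (a j) * z))))"

definition blaschke_vertices :: "(complex \<Rightarrow> complex) \<Rightarrow> complex \<Rightarrow> complex set" where
  "blaschke_vertices B w = {z. norm z = 1 \<and> B z = w}"

definition ellipse :: "complex \<Rightarrow> complex \<Rightarrow> real \<Rightarrow> complex set" where
  "ellipse f1 f2 r = {z. dist z f1 + dist z f2 = 2 * r}"

definition is_ellipse :: "complex set \<Rightarrow> bool" where
  "is_ellipse E \<longleftrightarrow> (\<exists>f1 f2 r. dist f1 f2 < 2 * r \<and> E = ellipse f1 f2 r)"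

definition inscribed_in_polygon :: "complex set \<Rightarrow> complex set \<Rightarrow> bool" where
  "inscribed_in_polygon E S \<longleftrightarrow>
     E \<subseteq> convex hull S \<and>
     (\<forall>a\<in>S. \<forall>b\<in>S. a \<noteq> b \<and> closed_segment a b \<subseteq> frontier (convex hull S)
        \<longrightarrow> closed_segment a b \<inter> E \<noteq> {})"

text \<open>The Blaschke curve of B is an ellipse: some ellipse is inscribed in every Blaschke
  polygon of B (it is then the envelope of all sides, i.e. the Blaschke curve).\<close>
definition blaschke_curve_is_ellipse :: "(complex \<Rightarrow> complex) \<Rightarrow> bool" where
  "blaschke_curve_is_ellipse B \<longleftrightarrow>
     (\<exists>E. is_ellipse E \<and>
        (\<forall>w. norm w = 1 \<longrightarrow> inscribed_in_polygon E (blaschke_vertices B w)))"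

end

theory Submission
  imports Defs "HOL-Complex_Analysis.Complex_Analysis"
begin

text \<open>Lift \<open>B\<close> to \<open>B (cis t) = cis (h t)\<close> with \<open>h\<close> increasing. The map \<open>\<tau>\<close> from a point of the circle to
  the next vertex of its polygon then lifts to \<open>t \<mapsto> h\<inverse> (h t + 2\<pi>)\<close>. Since the sides are tangent to an
  ellipse, \<open>\<tau> z\<close> and \<open>\<tau>\<inverse> z\<close> are the two roots of a quadratic equation whose coefficients are
  rational in \<open>z\<close> without poles in the closed disc. Iterating, the symmetric functions of
  \<open>\<tau>\<^sup>j z\<close> and \<open>\<tau>\<^sup>-\<^sup>j z\<close> extend to the disc algebra for every \<open>j\<close>: the monodromy of the fibres
  is dihedral. With \<open>n = k m\<close>, the product \<open>D\<close> of the \<open>m\<close> points \<open>\<tau>\<^sup>k\<^sup>l z\<close> can be arranged in such pairs,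
  so it extends to the disc; being unimodular on the circle it is a Blaschke product, of degree \<open>m\<close> by
  counting turns. It is \<open>\<tau>\<^sup>k\<close>-invariant, so each fibre of \<open>B\<close> over the circle is a union of \<open>k\<close> fibres
  of \<open>D\<close>; comparing polynomials over two such fibres exhibits \<open>B\<close> as a rational function of \<open>D\<close>.\<close>

section \<open>Unimodular functions in the disc algebra\<close>

definition disc_algebra :: "(complex \<Rightarrow> complex) set" where
  "disc_algebra = {f. continuous_on (cball 0 1) f \<and> f holomorphic_on ball 0 1}"

lemma disc_algebra_const: "(\<lambda>z. c) \<in> disc_algebra"
  and disc_algebra_ident: "(\<lambda>z. z) \<in> disc_algebra"
  by (auto simp: disc_algebra_def intro!: continuous_intros holomorphic_intros)

lemma disc_algebra_add: "f \<in> disc_algebra \<Longrightarrow> g \<in> disc_algebra \<Longrightarrow> (\<lambda>z. f z + g z) \<in> disc_algebra"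
  and disc_algebra_diff: "f \<in> disc_algebra \<Longrightarrow> g \<in> disc_algebra \<Longrightarrow> (\<lambda>z. f z - g z) \<in> disc_algebra"
  and disc_algebra_mult: "f \<in> disc_algebra \<Longrightarrow> g \<in> disc_algebra \<Longrightarrow> (\<lambda>z. f z * g z) \<in> disc_algebra"
  and disc_algebra_power: "f \<in> disc_algebra \<Longrightarrow> (\<lambda>z. f z ^ m) \<in> disc_algebra"
  by (auto simp: disc_algebra_def intro!: continuous_intros holomorphic_intros)

lemma disc_algebra_prod:
  "(\<And>i. i \<in> I \<Longrightarrow> f i \<in> disc_algebra) \<Longrightarrow> (\<lambda>z. \<Prod>i\<in>I. f i z) \<in> disc_algebra"
  by (auto simp: disc_algebra_def intro!: continuous_intros holomorphic_intros)

lemma disc_algebra_divide: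
  "f \<in> disc_algebra \<Longrightarrow> g \<in> disc_algebra \<Longrightarrow> (\<And>z. norm z \<le> 1 \<Longrightarrow> g z \<noteq> 0)
    \<Longrightarrow> (\<lambda>z. f z / g z) \<in> disc_algebra"
  by (auto simp: disc_algebra_def intro!: continuous_intros holomorphic_intros)

lemmas disc_algebra_intros = disc_algebra_const disc_algebra_ident disc_algebra_add
  disc_algebra_diff disc_algebra_mult disc_algebra_power disc_algebra_prod disc_algebra_divide

lemma disc_algebra_norm_le:
  assumes f: "f \<in> disc_algebra" and le: "\<And>z. norm z = 1 \<Longrightarrow> norm (f z) \<le> M" and z: "norm z \<le> 1"
  shows "norm (f z) \<le> M"
  by (rule maximum_modulus_frontier[of f "cball 0 1"])
    (use f le z in \<open>auto simp: disc_algebra_def\<close>)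

text \<open>The maximum principle for \<open>f\<close> and for \<open>1 / f\<close> forces modulus
  one on the whole disc, so the modulus has an interior maximum.\<close>

lemma disc_algebra_zero_free_const:
  assumes f: "f \<in> disc_algebra" and uni: "\<And>z. norm z = 1 \<Longrightarrow> norm (f z) = 1"
    and nz: "\<And>z. norm z < 1 \<Longrightarrow> f z \<noteq> 0"
  obtains c where "norm c = 1" "\<And>z. norm z \<le> 1 \<Longrightarrow> f z = c"
proof -
  have nz': "f z \<noteq> 0" if "norm z \<le> 1" for z
    using uni[of z] nz[of z] that by (cases "norm z = 1") auto
  have "(\<lambda>z. 1 / f z) \<in> disc_algebra"
    by (intro disc_algebra_intros f nz')
  then have inv_le: "norm (1 / f z) \<le> 1" if "norm z \<le> 1" for z
    using disc_algebra_norm_le[of "\<lambda>z. 1 / f z" 1 z] uni that by (simp add: norm_divide)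
  have ge: "norm (f z) \<ge> 1" if "norm z \<le> 1" for z
    using inv_le[OF that] nz'[OF that] by (simp add: norm_divide divide_le_eq_1)
  have le: "norm (f z) \<le> 1" if "norm z \<le> 1" for z
    using disc_algebra_norm_le[of f 1 z] f uni that by simp
  have "f constant_on ball 0 1"
    by (rule maximum_modulus_principle[where U = "ball 0 1" and \<xi> = 0])
      (use f order_trans[OF le ge[of 0]] in \<open>auto simp: disc_algebra_def\<close>)
  then obtain c where c: "\<And>z. z \<in> ball 0 1 \<Longrightarrow> f z = c"
    by (auto simp: constant_on_def)
  have "f z = c" if "norm z \<le> 1" for z
    by (rule continuous_constant_on_closure[of "ball 0 1" f c])
      (use f c that in \<open>auto simp: disc_algebra_def\<close>)
  moreover have "norm c = 1" using uni[of 1] calculation[of 1] by simp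
  ultimately show ?thesis using that by blast
qed

section \<open>Blaschke factors and the removal of zeros\<close>

definition blaschke_factor :: "complex \<Rightarrow> complex \<Rightarrow> complex" where
  "blaschke_factor a z = (z - a) / (1 - cnj a * z)"

lemma blaschke_denom_nz:
  fixes a z :: complex assumes "norm a < 1" "norm z \<le> 1" shows "1 - cnj a * z \<noteq> 0"
proof
  assume "1 - cnj a * z = 0"
  then have "norm (cnj a * z) = 1" by simp
  moreover have "norm (cnj a * z) \<le> norm a * 1"
    unfolding norm_mult complex_mod_cnj by (rule mult_left_mono) (use assms in auto)
  ultimately show False using assms by simp
qed

text \<open>The sign of the right-hand side gives modulus one on the circle and modulus below one
  inside it.\<close>

lemma blaschke_factor_defect:
  fixes a z :: complex
  shows "(norm (1 - cnj a * z))\<^sup>2 - (norm (z - a))\<^sup>2 = (1 - (norm a)\<^sup>2) * (1 - (norm z)\<^sup>2)"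
  unfolding cmod_power2 by (simp add: power2_eq_square algebra_simps)

lemma norm_blaschke_factor_eq:
  assumes "norm a < 1" "norm z = 1" shows "norm (blaschke_factor a z) = 1"
proof -
  have "(norm (1 - cnj a * z))\<^sup>2 = (norm (z - a))\<^sup>2"
    using blaschke_factor_defect[of a z] assms by simp
  then have "norm (1 - cnj a * z) = norm (z - a)" by simp
  moreover have "norm (1 - cnj a * z) \<noteq> 0" using blaschke_denom_nz[of a z] assms by simp
  ultimately show ?thesis unfolding blaschke_factor_def norm_divide by simp
qed

lemma norm_blaschke_factor_less:
  assumes "norm a < 1" "norm z < 1" shows "norm (blaschke_factor a z) < 1"
proof -
  have "(1 - (norm a)\<^sup>2) * (1 - (norm z)\<^sup>2) > 0"
    using assms by (intro mult_pos_pos) (auto simp: power_less_one_iff abs_square_less_1)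
  then have "(norm (z - a))\<^sup>2 < (norm (1 - cnj a * z))\<^sup>2"
    using blaschke_factor_defect[of a z] by simp
  then have "norm (z - a) < norm (1 - cnj a * z)" by (rule power_less_imp_less_base) simp
  then show ?thesis unfolding blaschke_factor_def norm_divide by (simp add: divide_simps)
qed

lemma blaschke_factor_in_disc_algebra: "norm a < 1 \<Longrightarrow> blaschke_factor a \<in> disc_algebra"
  unfolding blaschke_factor_def[abs_def]
  by (intro disc_algebra_intros) (rule blaschke_denom_nz)

text \<open>The difference quotient has a removable singularity at the interior zero
  \<open>a\<close>; the cofactor is this quotient times the denominator of the Blaschke
  factor.\<close>

lemma disc_algebra_divide_factor:
  assumes f: "f \<in> disc_algebra" and a: "norm a < 1" and fa: "f a = 0"
  obtains g where "g \<in> disc_algebra" "\<And>z. norm z \<le> 1 \<Longrightarrow> f z = blaschke_factor a z * g z"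
proof -
  define h where "h = (\<lambda>z. if z = a then deriv f a else (f z - f a) / (z - a))"
  have hol: "h holomorphic_on ball 0 1"
    unfolding h_def by (rule pole_lemma) (use f a in \<open>auto simp: disc_algebra_def\<close>)
  have "continuous_on (cball 0 1) h"
  proof (unfold continuous_on_eq_continuous_within, rule)
    fix x :: complex assume x: "x \<in> cball 0 1"
    show "continuous (at x within cball 0 1) h"
    proof (cases "x = a")
      case True
      have "continuous_on (ball 0 1) h" by (rule holomorphic_on_imp_continuous_on[OF hol])
      then have "isCont h x" using True a by (simp add: continuous_on_eq_continuous_at)
      then show ?thesis by (rule continuous_at_imp_continuous_at_within)
    next
      case False
      have "continuous (at x within cball 0 1) f"
        using f x by (auto simp: disc_algebra_def continuous_on_eq_continuous_within)
      then have "continuous (at x within cball 0 1) (\<lambda>z. (f z - f a) / (z - a))"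
        using False by (intro continuous_intros) auto
      then show ?thesis
      proof (rule continuous_transform_within[of x _ _ "dist x a"])
        show "0 < dist x a" using False by simp
        show "x \<in> cball 0 1" by fact
        show "(f x' - f a) / (x' - a) = h x'" if "x' \<in> cball 0 1" "dist x' x < dist x a" for x'
          using that by (auto simp: h_def dist_commute)
      qed
    qed
  qed
  with hol have h: "h \<in> disc_algebra" by (simp add: disc_algebra_def)
  show ?thesis
  proof (rule that[of "\<lambda>z. (1 - cnj a * z) * h z"])
    show "(\<lambda>z. (1 - cnj a * z) * h z) \<in> disc_algebra" by (intro disc_algebra_intros h)
    show "f z = blaschke_factor a z * ((1 - cnj a * z) * h z)" if "norm z \<le> 1" for z
      using blaschke_denom_nz[OF a that] fa by (auto simp: blaschke_factor_def h_def)
  qed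
qed

text \<open>Zeros are split off one at a time. The cofactor keeps modulus one on the circle, so once
  it has no zeros left it is constant. The process stops because, at a point where \<open>f\<close>
  does not vanish, every factor costs a fixed ratio below one.\<close>

lemma blaschke_of_unimodular:
  assumes f: "f \<in> disc_algebra" and uni: "\<And>z. norm z = 1 \<Longrightarrow> norm (f z) = 1"
  obtains d b where "blaschke d b" "\<And>z. norm z \<le> 1 \<Longrightarrow> f z = b z"
proof -
  define Z where "Z = {z \<in> cball 0 1. f z = 0}"
  have cont: "continuous_on (cball 0 1) f" using f by (simp add: disc_algebra_def)
  have Z1: "norm a < 1" if "a \<in> Z" for a
    using that uni[of a] by (cases "norm a = 1") (auto simp: Z_def)
  have "closedin (top_of_set (cball 0 1)) (cball 0 1 \<inter> f -` {0})"
    by (rule continuous_closedin_preimage[OF cont]) simp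
  then have "closed (cball 0 1 \<inter> f -` {0})"
    using closedin_closed_trans by blast
  moreover have "Z = cball 0 1 \<inter> f -` {0}" by (auto simp: Z_def)
  ultimately have compZ: "compact Z"
    by (simp add: bounded_Int compact_eq_bounded_closed)
  have "\<exists>z0. norm z0 < 1 \<and> f z0 \<noteq> 0"
  proof (rule ccontr)
    assume "\<nexists>z0. norm z0 < 1 \<and> f z0 \<noteq> 0"
    then have "f z = 0" if "z \<in> ball 0 1" for z using that by auto
    then have "f 1 = 0"
      using continuous_constant_on_closure[of "ball 0 1" f 0 1] cont by auto
    then show False using uni[of 1] by simp
  qed
  then obtain z0 where z0: "norm z0 < 1" "f z0 \<noteq> 0" by blast
  \<comment> \<open>The zeros form a compact subset of the open disc, so their factors at
    \<open>z0\<close> have a common bound below one.\<close>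
  obtain \<rho> where \<rho>: "0 \<le> \<rho>" "\<rho> < 1" "\<And>a. a \<in> Z \<Longrightarrow> norm (blaschke_factor a z0) \<le> \<rho>"
  proof (cases "Z = {}")
    case True then show ?thesis using that[of 0] by simp
  next
    case False
    have "continuous_on Z (\<lambda>a. norm (blaschke_factor a z0))"
      unfolding blaschke_factor_def
      using Z1 z0 blaschke_denom_nz by (auto intro!: continuous_intros)
    from continuous_attains_sup[OF compZ False this] obtain a0
      where "a0 \<in> Z" "\<forall>a\<in>Z. norm (blaschke_factor a z0) \<le> norm (blaschke_factor a0 z0)" by blast
    then show ?thesis
      using that[of "norm (blaschke_factor a0 z0)"] norm_blaschke_factor_less[OF Z1 z0(1)] by auto
  qed
  define P where "P d \<longleftrightarrow> (\<exists>a g. (\<forall>j<d. a j \<in> Z) \<and> g \<in> disc_algebra \<and>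
      (\<forall>z. norm z \<le> 1 \<longrightarrow> f z = (\<Prod>j<d. blaschke_factor (a j) z) * g z))" for d :: nat
  have uni_prod: "norm (\<Prod>j<d. blaschke_factor (a j) z) = 1"
    if "\<forall>j<d. a j \<in> Z" "norm z = 1" for a z and d :: nat
    unfolding prod_norm[symmetric] using that Z1 by (intro prod.neutral) (auto simp: norm_blaschke_factor_eq)
  have uni_g: "norm (g z) = 1" if "\<forall>j<d. a j \<in> Z" "norm z = 1"
      "f z = (\<Prod>j<d. blaschke_factor (a j) z) * g z" for a g z and d :: nat
    using uni[OF that(2)] uni_prod[OF that(1,2)] that(3) by (simp add: norm_mult)
  have P0: "P 0" unfolding P_def using f by auto
  obtain N where N: "\<rho> ^ N < norm (f z0)"
    using real_arch_pow_inv[of "norm (f z0)" \<rho>] z0 \<rho> by auto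
  have bound: "d \<le> N" if "P d" for d
  proof (rule ccontr)
    assume "\<not> d \<le> N"
    from that obtain a g where ag: "\<forall>j<d. a j \<in> Z" "g \<in> disc_algebra"
      "\<forall>z. norm z \<le> 1 \<longrightarrow> f z = (\<Prod>j<d. blaschke_factor (a j) z) * g z" unfolding P_def by blast
    have "norm (g z0) \<le> 1"
      by (rule disc_algebra_norm_le[OF ag(2)]) (use ag uni_g[OF ag(1)] z0 in auto)
    moreover have "norm (\<Prod>j<d. blaschke_factor (a j) z0) \<le> \<rho> ^ d"
      unfolding prod_norm[symmetric] using prod_mono[of "{..<d}" "\<lambda>j. norm (blaschke_factor (a j) z0)" "\<lambda>_. \<rho>"]
        \<rho> ag by auto
    ultimately have "norm (f z0) \<le> \<rho> ^ d * 1"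
      using ag(3) z0(1) \<rho> unfolding norm_mult[symmetric]
      by (metis less_imp_le mult_mono norm_ge_zero norm_mult zero_le_power)
    also have "\<dots> \<le> \<rho> ^ N" using \<rho> \<open>\<not> d \<le> N\<close> by (simp add: power_decreasing)
    finally show False using N by simp
  qed
  define d where "d = (GREATEST d. P d)"
  have Pd: "P d" unfolding d_def by (rule GreatestI_nat[of P 0 N, OF P0 bound])
  have notP: "\<not> P (Suc d)" using Greatest_le_nat[of P "Suc d" N] bound unfolding d_def by force
  from Pd obtain a g where ag: "\<forall>j<d. a j \<in> Z" "g \<in> disc_algebra"
      "\<forall>z. norm z \<le> 1 \<longrightarrow> f z = (\<Prod>j<d. blaschke_factor (a j) z) * g z" unfolding P_def by blast
  have nz: "g z \<noteq> 0" if z: "norm z < 1" for z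
  proof
    assume "g z = 0"
    then obtain h where h: "h \<in> disc_algebra" "\<And>w. norm w \<le> 1 \<Longrightarrow> g w = blaschke_factor z w * h w"
      using disc_algebra_divide_factor[OF ag(2) z] by blast
    have "z \<in> Z" using ag(3) z \<open>g z = 0\<close> by (auto simp: Z_def)
    then have "P (Suc d)" unfolding P_def
      using ag h by (intro exI[of _ "a(d := z)"] exI[of _ h]) (auto simp: less_Suc_eq)
    then show False using notP by simp
  qed
  obtain c where c: "norm c = 1" "\<And>z. norm z \<le> 1 \<Longrightarrow> g z = c"
    using disc_algebra_zero_free_const[OF ag(2) _ nz] uni_g[OF ag(1)] ag(3) by auto
  show ?thesis
  proof (rule that[of d "\<lambda>z. c * (\<Prod>j<d. blaschke_factor (a j) z)"])
    show "blaschke d (\<lambda>z. c * (\<Prod>j<d. blaschke_factor (a j) z))"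
      unfolding blaschke_def blaschke_factor_def using c ag(1) Z1 by blast
  qed (use ag c in auto)
qed

lemma blaschke_in_disc_algebra:
  assumes "blaschke n B" shows "B \<in> disc_algebra"
proof -
  obtain \<gamma> a where a: "\<forall>j<n. norm (a j) < 1" and B: "\<And>z. B z = \<gamma> * (\<Prod>j<n. blaschke_factor (a j) z)"
    using assms unfolding blaschke_def blaschke_factor_def by blast
  have "B = (\<lambda>z. \<gamma> * (\<Prod>j<n. blaschke_factor (a j) z))" using B by auto
  then show ?thesis using a
    by (auto intro!: disc_algebra_const disc_algebra_mult disc_algebra_prod blaschke_factor_in_disc_algebra)
qed

lemma norm_blaschke_eq:
  assumes "blaschke n B" "norm z = 1" shows "norm (B z) = 1"
proof -
  obtain \<gamma> a where "norm \<gamma> = 1" "\<forall>j<n. norm (a j) < 1"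
    and B: "\<And>z. B z = \<gamma> * (\<Prod>j<n. blaschke_factor (a j) z)"
    using assms unfolding blaschke_def blaschke_factor_def by blast
  then show ?thesis
    using assms(2) by (simp add: norm_mult prod_norm[symmetric] norm_blaschke_factor_eq)
qed

section \<open>Lifts of Blaschke products to the line\<close>

lemma cis_Arg_unit: "norm z = 1 \<Longrightarrow> cis (Arg z) = z"
  by (metis cis_Arg div_by_1 norm_zero of_real_1 sgn_eq zero_neq_one)

text \<open>With \<open>v = 1 - a * cis (- t)\<close> the factor equals
  \<open>cis t * (v / cnj v)\<close>. Since \<open>v\<close> stays in the right half-plane, the
  principal logarithm yields a continuous argument \<open>h\<close>; its derivative is the Poisson
  kernel, hence positive.\<close>

lemma blaschke_factor_lift:
  fixes a :: complex assumes a: "norm a < 1"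
  obtains h :: "real \<Rightarrow> real" where "continuous_on UNIV h" "\<And>t. blaschke_factor a (cis t) = cis (h t)"
    "\<And>t. h (t + 2 * pi) = h t + 2 * pi" "strict_mono h"
proof -
  define h where "h t = t + 2 * Im (Ln (1 - a * cis (- t)))" for t
  have y1: "norm (a * cis (- t)) < 1" for t using a by (simp add: norm_mult)
  have re: "Re (1 - a * cis (- t)) > 0" for t
    using y1[of t] complex_Re_le_cmod[of "a * cis (- t)"] by simp
  then have nonneg: "1 - a * cis (- t) \<notin> \<real>\<^sub>\<le>\<^sub>0" for t
    by (metis complex_nonpos_Reals_iff not_le)
  have eq: "blaschke_factor a (cis t) = cis (h t)" for t
  proof -
    define v where "v = 1 - a * cis (- t)"
    have v0: "v \<noteq> 0" using re[of t] unfolding v_def by (metis less_irrefl zero_complex.sel(1))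
    have e: "cis t - a = cis t * v" unfolding v_def by (simp add: algebra_simps cis_mult)
    have c: "1 - cnj a * cis t = cnj v" unfolding v_def by (simp add: cis_cnj)
    have "v / cnj v = exp (Ln v) / exp (cnj (Ln v))"
      using v0 by (simp flip: exp_cnj)
    also have "\<dots> = exp (Ln v - cnj (Ln v))" by (simp add: exp_diff)
    also have "\<dots> = cis (2 * Im (Ln v))" by (simp add: complex_diff_cnj cis_conv_exp mult_ac)
    finally show ?thesis unfolding blaschke_factor_def e c h_def v_def[symmetric]
      by (metis cis_mult times_divide_eq_right)
  qed
  have "cis (- (t + 2 * pi)) = cis (- t)" for t
    by (metis cis_cnj complex_eq_iff cis.sel cos_periodic sin_periodic)
  then have per: "h (t + 2 * pi) = h t + 2 * pi" for t unfolding h_def by simp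
  have der: "\<exists>D>0. (h has_real_derivative D) (at t)" for t
  proof -
    define y where "y = a * cis (- t)"
    have e: "cis (- x) = exp (- (\<i> * of_real x))" for x by (simp add: cis_conv_exp)
    have "((\<lambda>z. Ln (1 - a * exp (- (\<i> * z)))) has_field_derivative (\<i> * y / (1 - y))) (at (of_real t))"
      unfolding y_def using nonneg[of t] unfolding e
      by (auto intro!: derivative_eq_intros simp: divide_inverse mult_ac)
    from has_vector_derivative_real_field[OF this]
    have "((\<lambda>x. Ln (1 - a * cis (- x))) has_vector_derivative (\<i> * y / (1 - y))) (at t)"
      unfolding e .
    from bounded_linear.has_vector_derivative[OF bounded_linear_Im this]
    have "((\<lambda>x. Im (Ln (1 - a * cis (- x)))) has_real_derivative Im (\<i> * y / (1 - y))) (at t)"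
      unfolding has_real_derivative_iff_has_vector_derivative .
    from DERIV_add[OF DERIV_ident DERIV_cmult[OF this, of 2]]
    have "(h has_real_derivative 1 + 2 * Im (\<i> * y / (1 - y))) (at t)"
      unfolding h_def[abs_def] .
    moreover have "1 + 2 * Im (\<i> * y / (1 - y)) > 0"
    proof -
      have y: "norm y < 1" unfolding y_def by (rule y1)
      then have nz: "norm (1 - y) \<noteq> 0" by auto
      have "Im (\<i> * y / (1 - y)) = (Re y - (norm y)\<^sup>2) / (norm (1 - y))\<^sup>2"
        unfolding Im_divide cmod_power2 by (simp add: power2_eq_square algebra_simps)
      then have "1 + 2 * Im (\<i> * y / (1 - y)) =
          ((norm (1 - y))\<^sup>2 + 2 * (Re y - (norm y)\<^sup>2)) / (norm (1 - y))\<^sup>2"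
        using nz by (simp add: field_simps)
      also have "(norm (1 - y))\<^sup>2 + 2 * (Re y - (norm y)\<^sup>2) = 1 - (norm y)\<^sup>2"
        unfolding cmod_power2 by (simp add: power2_eq_square algebra_simps)
      finally show ?thesis using y nz by (simp add: abs_square_less_1)
    qed
    ultimately show ?thesis by blast
  qed
  have cont: "continuous_on UNIV h"
    using der by (metis DERIV_isCont continuous_at_imp_continuous_on)
  have "strict_mono h"
    by (rule strict_monoI, rule DERIV_pos_imp_increasing) (use der in blast)+
  with cont eq per show thesis by (rule that)
qed

lemma blaschke_lift:
  assumes "blaschke n B"
  obtains h :: "real \<Rightarrow> real" where "continuous_on UNIV h" "\<And>t. B (cis t) = cis (h t)"
    "\<And>t. h (t + 2 * pi) = h t + 2 * pi * real n" "n > 0 \<Longrightarrow> strict_mono h"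
proof -
  obtain \<gamma> a where \<gamma>: "norm \<gamma> = 1" and a: "\<forall>j<n. norm (a j) < 1"
    and B: "\<And>z. B z = \<gamma> * (\<Prod>j<n. blaschke_factor (a j) z)"
    using assms unfolding blaschke_def blaschke_factor_def by blast
  have "\<forall>j. \<exists>g. j < n \<longrightarrow> continuous_on UNIV g \<and> (\<forall>t. blaschke_factor (a j) (cis t) = cis (g t)) \<and>
      (\<forall>t. g (t + 2 * pi) = g t + 2 * pi) \<and> strict_mono g"
    using blaschke_factor_lift a by metis
  then obtain h :: "nat \<Rightarrow> real \<Rightarrow> real" where
    h: "\<And>j. j < n \<Longrightarrow> continuous_on UNIV (h j)"
       "\<And>j t. j < n \<Longrightarrow> blaschke_factor (a j) (cis t) = cis (h j t)"
       "\<And>j t. j < n \<Longrightarrow> h j (t + 2 * pi) = h j t + 2 * pi"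
       "\<And>j. j < n \<Longrightarrow> strict_mono (h j)" by metis
  define H where "H t = Arg \<gamma> + (\<Sum>j<n. h j t)" for t
  have cis_sum: "(\<Prod>j\<in>J. cis (f j)) = cis (\<Sum>j\<in>J. f j)" if "finite J" for J and f :: "nat \<Rightarrow> real"
    using that by (induction J) (auto simp: cis_mult)
  show ?thesis
  proof (rule that[of H])
    show "continuous_on UNIV H" unfolding H_def
      using h(1) by (intro continuous_intros) auto
    show "B (cis t) = cis (H t)" for t
    proof -
      have "\<gamma> = cis (Arg \<gamma>)" using \<gamma> by (simp add: cis_Arg_unit)
      moreover have "(\<Prod>j<n. blaschke_factor (a j) (cis t)) = (\<Prod>j<n. cis (h j t))"
        using h(2) by (intro prod.cong) auto
      ultimately show ?thesis unfolding B H_def by (simp add: cis_sum flip: cis_mult)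
    qed
    show "H (t + 2 * pi) = H t + 2 * pi * real n" for t
      unfolding H_def using h(3) by (simp add: sum.distrib)
    show "strict_mono H" if "n > 0"
    proof (rule strict_monoI)
      fix s t :: real assume "s < t"
      then have "(\<Sum>j<n. h j s) < (\<Sum>j<n. h j t)"
        using h(4) that by (intro sum_strict_mono) (auto simp: strict_mono_def)
      then show "H s < H t" by (simp add: H_def)
    qed
  qed
qed

section \<open>Degrees of circle maps and the points of a fibre\<close>

lemma cis_eq_iff: "cis s = cis t \<longleftrightarrow> (\<exists>i::int. s = t + 2 * pi * of_int i)"
proof
  assume "cis s = cis t"
  then have "sin s = sin t \<and> cos s = cos t" by (simp add: complex_eq_iff)
  then show "\<exists>i::int. s = t + 2 * pi * of_int i"
    using sin_cos_eq_iff[of s t] by auto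
next
  assume "\<exists>i::int. s = t + 2 * pi * of_int i"
  then obtain i :: int where "s = t + 2 * pi * of_int i" by blast
  then show "cis s = cis t" by (simp add: cis_mult[symmetric] cis_multiple_2pi)
qed

text \<open>Two lifts of one circle map differ by a continuous function with values in the integer
  multiples of \<open>2 * pi\<close>, hence by a constant. The degrees of \<open>D\<close> and
  \<open>C\<close> are found this way.\<close>

lemma lift_degree_unique:
  fixes f g :: "real \<Rightarrow> real"
  assumes cont: "continuous_on UNIV f" "continuous_on UNIV g"
    and eq: "\<And>t. cis (f t) = cis (g t)"
    and f: "\<And>t. f (t + 2 * pi) = f t + 2 * pi * a"
    and g: "\<And>t. g (t + 2 * pi) = g t + 2 * pi * b"
  shows "a = b"
proof -
  define h where "h t = (f t - g t) / (2 * pi)" for t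
  have int: "\<exists>i::int. h t = of_int i" for t
  proof -
    obtain i :: int where "f t = g t + 2 * pi * of_int i" using eq cis_eq_iff by blast
    then show ?thesis by (intro exI[of _ i]) (simp add: h_def)
  qed
  have "h constant_on UNIV"
  proof (rule continuous_discrete_range_constant)
    show "continuous_on UNIV h" unfolding h_def using cont by (intro continuous_intros) auto
    show "\<exists>e>0. \<forall>y. y \<in> UNIV \<and> h y \<noteq> h x \<longrightarrow> e \<le> norm (h y - h x)" for x
    proof (intro exI[of _ 1] conjI allI impI)
      fix y assume y: "y \<in> UNIV \<and> h y \<noteq> h x"
      obtain i j :: int where ij: "h x = of_int i" "h y = of_int j" using int by meson
      with y have "\<bar>j - i\<bar> \<ge> 1" by auto
      then show "1 \<le> norm (h y - h x)" using ij
        by (metis of_int_1_le_iff of_int_abs of_int_diff real_norm_def)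
    qed simp
  qed auto
  then have "h (0 + 2 * pi) = h 0" by (auto simp: constant_on_def)
  then show ?thesis unfolding h_def f g by simp
qed

text \<open>Only the lift is fixed, not the Blaschke product, so that the locale serves both for
  \<open>B\<close> and for the inner factor \<open>D\<close>.\<close>

locale circle_lift =
  fixes n :: nat and h :: "real \<Rightarrow> real"
  assumes cont: "continuous_on UNIV h" and mono: "strict_mono h"
    and period: "\<And>t. h (t + 2 * pi) = h t + 2 * pi * real n"
    and n_pos: "n > 0"
begin

lemma period_nat: "h (t + 2 * pi * real i) = h t + 2 * pi * real n * real i"
proof (induction i)
  case (Suc i)
  have "h (t + 2 * pi * real (Suc i)) = h (t + 2 * pi * real i + 2 * pi)"
    by (simp add: algebra_simps)
  then show ?case unfolding period Suc.IH by (simp add: algebra_simps)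
qed simp

lemma period_int: "h (t + 2 * pi * of_int i) = h t + 2 * pi * real n * of_int i"
proof (cases "i \<ge> 0")
  case True
  then show ?thesis using period_nat[of t "nat i"] by simp
next
  case False
  then show ?thesis using period_nat[of "t + 2 * pi * of_int i" "nat (- i)"]
    by (simp add: algebra_simps)
qed

lemma surj: "surj h"
proof -
  have "\<exists>t. h t = y" for y
  proof -
    define x where "x = (y - h 0) / (2 * pi * real n)"
    have y: "y = h 0 + 2 * pi * real n * x" unfolding x_def using n_pos by simp
    have "h (0 + 2 * pi * of_int \<lfloor>x\<rfloor>) \<le> y"
      unfolding period_int y using n_pos by (simp add: mult_left_mono)
    moreover have "y \<le> h (0 + 2 * pi * of_int \<lceil>x\<rceil>)"
      unfolding period_int y using n_pos by (simp add: mult_left_mono)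
    moreover have "0 + 2 * pi * of_int \<lfloor>x\<rfloor> \<le> (0 + 2 * pi * of_int \<lceil>x\<rceil> :: real)"
      by (intro add_left_mono mult_left_mono) (auto simp: floor_le_ceiling)
    ultimately show ?thesis
      using IVT'[of h] continuous_on_subset[OF cont] by (meson subset_UNIV)
  qed
  then show ?thesis by (metis surjI someI_ex surj_def)
qed

lemma inj: "inj h"
  using mono by (rule strict_mono_imp_inj_on)

text \<open>The lift of the \<open>j\<close>-th iterate of the map to the next fibre point. Integer
  indices make this an action of the integers in which index \<open>n\<close> is a full
  turn.\<close>

definition shift :: "int \<Rightarrow> real \<Rightarrow> real" where
  "shift j t = inv h (h t + 2 * pi * of_int j)"

lemma h_shift: "h (shift j t) = h t + 2 * pi * of_int j"
  unfolding shift_def by (rule surj_f_inv_f[OF surj])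

lemma shift_eqI: "h s = h t + 2 * pi * of_int j \<Longrightarrow> shift j t = s"
  unfolding shift_def using inj by (metis inv_f_f)

lemma shift_0 [simp]: "shift 0 t = t"
  by (rule shift_eqI) simp

lemma shift_shift: "shift i (shift j t) = shift (i + j) t"
  by (rule shift_eqI) (simp add: h_shift algebra_simps)

lemma shift_n_mult: "shift (int n * i) t = t + 2 * pi * of_int i"
  by (rule shift_eqI) (simp add: period_int)

lemma shift_add_period: "shift j (t + 2 * pi) = shift j t + 2 * pi"
  by (rule shift_eqI) (simp add: period h_shift)

lemma shift_less_iff: "shift i t < shift j t \<longleftrightarrow> i < j"
  using strict_mono_less[OF mono, of "shift i t" "shift j t"] by (simp add: h_shift)

lemma continuous_shift: "continuous_on UNIV (shift j)"
proof -
  have "isCont (inv h) (h x)" for x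
    by (rule isCont_inverse_function[of 1])
      (use cont inj in \<open>auto simp: continuous_on_eq_continuous_at\<close>)
  then have "isCont (inv h) y" for y using surj by (metis surjE)
  then have c: "continuous_on UNIV (inv h)" by (simp add: continuous_on_eq_continuous_at)
  show ?thesis unfolding shift_def
    by (rule continuous_on_compose2[OF c]) (auto intro!: continuous_intros cont)
qed

definition fib :: "int \<Rightarrow> real \<Rightarrow> complex" where
  "fib j t = cis (shift j t)"

text \<open>Index \<open>n\<close> is a full turn, and strict monotonicity in the index excludes any
  other coincidence.\<close>

lemma fib_eq_iff: "fib i t = fib j t \<longleftrightarrow> int n dvd i - j"
proof
  assume "fib i t = fib j t"
  then obtain l :: int where "shift i t = shift j t + 2 * pi * of_int l"
    unfolding fib_def cis_eq_iff by blast
  also have "\<dots> = shift (int n * l + j) t" by (simp add: shift_n_mult flip: shift_shift)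
  finally show "int n dvd i - j"
    using shift_less_iff[of i t "int n * l + j"] shift_less_iff[of "int n * l + j" t i] by auto
next
  assume "int n dvd i - j"
  then obtain l where "i - j = int n * l" by blast
  then have "i = int n * l + j" by simp
  then have "shift i t = shift j t + 2 * pi * of_int l" by (simp add: shift_n_mult flip: shift_shift)
  then show "fib i t = fib j t" unfolding fib_def cis_eq_iff by blast
qed

lemma cis_h_eq_iff: "cis (h s) = cis (h t) \<longleftrightarrow> (\<exists>j. s = shift j t)"
  by (metis cis_eq_iff h_shift shift_eqI)

end

section \<open>Chords tangent to an ellipse\<close>

text \<open>Certifies a chord as a side of the polygon: a point on the boundary line of a half-plane
  containing the hull cannot be interior to the hull.\<close>

lemma segment_frontier_of_supporting_line:
  fixes S :: "complex set" and u :: complex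
  assumes u: "norm u = 1" and S: "\<And>z. z \<in> S \<Longrightarrow> Re (z * cnj u) \<le> c"
    and ab: "a \<in> S" "b \<in> S" "Re (a * cnj u) = c" "Re (b * cnj u) = c"
  shows "convex hull S \<subseteq> {z. Re (z * cnj u) \<le> c}"
    and "closed_segment a b \<subseteq> frontier (convex hull S)"
    and "closed_segment a b \<subseteq> {z. Re (z * cnj u) = c}"
proof -
  have inner: "Re (z * cnj u) = inner u z" for z
    by (simp add: inner_complex_def mult_ac)
  show hull: "convex hull S \<subseteq> {z. Re (z * cnj u) \<le> c}"
    by (rule hull_minimal) (use S in \<open>auto simp del: times_complex.sel simp: inner convex_halfspace_le\<close>)
  show line: "closed_segment a b \<subseteq> {z. Re (z * cnj u) = c}"
    by (rule closed_segment_subset) (use ab in \<open>auto simp del: times_complex.sel simp: inner convex_hyperplane\<close>)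
  show "closed_segment a b \<subseteq> frontier (convex hull S)"
  proof
    fix x assume x: "x \<in> closed_segment a b"
    then have "x \<in> convex hull S"
      using ab by (meson closed_segment_subset convex_convex_hull hull_inc subsetD)
    moreover have "x \<notin> interior (convex hull S)"
    proof
      assume "x \<in> interior (convex hull S)"
      then have "x \<in> interior {z. inner u z \<le> c}"
        using interior_mono[OF hull] unfolding inner by blast
      moreover have "u \<noteq> 0" using u by auto
      ultimately have "inner u x < c" by (simp add: interior_halfspace_le)
      then show False using line x unfolding inner by auto
    qed
    ultimately show "x \<in> frontier (convex hull S)"
      by (simp add: frontier_def closure_subset[THEN subsetD])
  qed
qed

text \<open>The sum of the focal distances starts below \<open>2 * r\<close> and reaches it far out,
  so the intermediate value theorem applies.\<close>

lemma ellipse_ray: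
  assumes r: "dist x f1 + dist x f2 < 2 * r" and u: "norm u = 1"
  obtains t where "t > 0" "x + of_real t * u \<in> ellipse f1 f2 r"
proof -
  define g where "g t = dist (x + of_real t * u) f1 + dist (x + of_real t * u) f2" for t :: real
  \<comment> \<open>By the triangle inequality this length puts the end point at distance at least
    \<open>2 * \<bar>r\<bar>\<close> from \<open>f1\<close>.\<close>
  define T where "T = dist x f1 + 2 * \<bar>r\<bar>"
  have T: "T \<ge> 0" by (simp add: T_def)
  have "norm (of_real T * u) \<le> dist (x + of_real T * u) f1 + dist x f1"
    using norm_triangle_ineq4[of "x + of_real T * u - f1" "x - f1"] by (simp add: dist_norm)
  then have "T \<le> dist (x + of_real T * u) f1 + dist x f1"
    using u T by (simp add: norm_mult)
  then have "2 * r \<le> g T"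
    unfolding g_def using zero_le_dist[of "x + of_real T * u" f2] abs_ge_self[of r] T_def by linarith
  moreover have "continuous_on {0..T} g" unfolding g_def by (intro continuous_intros)
  moreover have g0: "g 0 < 2 * r" using r by (simp add: g_def)
  ultimately obtain t where "0 \<le> t" "g t = 2 * r" using T IVT'[of g 0 "2 * r" T] by auto
  moreover have "t \<noteq> 0" using g0 calculation by auto
  ultimately show ?thesis using that[of t] by (simp add: g_def ellipse_def)
qed

text \<open>The ray from the focus pointing away from the origin meets the ellipse, at a point of
  strictly larger modulus.\<close>

lemma ellipse_focus_in_disc:
  assumes r: "dist f1 f2 < 2 * r" and E: "ellipse f1 f2 r \<subseteq> cball 0 1"
  shows "norm f1 < 1"
proof -
  define u where "u = (if f1 = 0 then 1 else sgn f1)"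
  have u: "norm u = 1" "f1 = of_real (norm f1) * u"
    by (auto simp: u_def norm_sgn) (simp add: sgn_eq)
  obtain t where t: "t > 0" "f1 + of_real t * u \<in> ellipse f1 f2 r"
    using ellipse_ray[of f1 f1 f2 r u] r u by auto
  have "f1 + of_real t * u = of_real (norm f1 + t) * u"
    using u(2) by (metis of_real_add ring_class.ring_distribs(2))
  then have "norm (f1 + of_real t * u) = norm f1 + t"
    using u(1) t(1) by (simp add: norm_mult del: of_real_add)
  then show ?thesis using t E by force
qed

lemma ellipse_commute: "ellipse f1 f2 r = ellipse f2 f1 r"
  by (auto simp: ellipse_def)

text \<open>The point \<open>of_real (2 * c) * u - cnj f1 * u\<^sup>2\<close> is the mirror image of the focus \<open>f1\<close> in the
  supporting line; the broken path between the foci over a point of that line has the same length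
  as the straightened one, so the minimal length \<open>2 * r\<close> is attained on a segment.\<close>

lemma ellipse_tangent_line:
  assumes u: "norm u = 1" and r: "dist f1 f2 < 2 * r"
    and side: "ellipse f1 f2 r \<subseteq> {z. Re (z * cnj u) \<le> c}"
    and e: "e \<in> ellipse f1 f2 r" "Re (e * cnj u) = c"
  shows "norm (of_real (2 * c) * u - cnj f1 * u\<^sup>2 - f2) = 2 * r"
proof -
  define f where "f = of_real (2 * c) * u - cnj f1 * u\<^sup>2"
  have uu: "u * cnj u = 1" using u by (simp add: complex_norm_square[symmetric])
  have Re_ray: "Re ((x + of_real t * u) * cnj u) = Re (x * cnj u) + t" for x t
    using uu by (simp add: distrib_right mult.assoc)
  have inner: "Re (z * cnj u) = inner u z" for z
    by (simp add: inner_complex_def mult_ac)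
  have refl: "dist x f = dist x f1" if "Re (x * cnj u) = c" for x
  proof -
    have "of_real (2 * c) = x * cnj u + cnj x * u"
      unfolding that[symmetric] by (metis complex_add_cnj complex_cnj_cnj complex_cnj_mult)
    then have "of_real (2 * c) * u = (x * cnj u + cnj x * u) * u" by simp
    also have "\<dots> = x + cnj x * u\<^sup>2" using uu by (simp add: algebra_simps power2_eq_square)
    finally have "f - x = cnj (x - f1) * u\<^sup>2" unfolding f_def by (simp add: algebra_simps)
    then have "norm (f - x) = norm (x - f1)" using u by (simp add: norm_mult norm_power del: complex_cnj_diff)
    then show ?thesis by (simp add: dist_norm norm_minus_commute)
  qed
  \<comment> \<open>From a point of the line inside the ellipse, moving along \<open>u\<close> would
    reach a point of the ellipse beyond the line.\<close>
  have ge: "dist x f1 + dist x f2 \<ge> 2 * r" if x: "Re (x * cnj u) = c" for x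
  proof (rule ccontr)
    assume "\<not> ?thesis"
    then obtain t where t: "t > 0" "x + of_real t * u \<in> ellipse f1 f2 r"
      using ellipse_ray[of x f1 f2 r u] u by auto
    then have "Re ((x + of_real t * u) * cnj u) \<le> c" using side by blast
    then show False unfolding Re_ray using t x by simp
  qed
  have focus: "Re (f' * cnj u) \<le> c" if f': "dist f' f1 + dist f' f2 < 2 * r" for f'
  proof -
    obtain t where t: "t > 0" "f' + of_real t * u \<in> ellipse f1 f2 r"
      using ellipse_ray[OF f' u] by blast
    then have "Re ((f' + of_real t * u) * cnj u) \<le> c" using side by blast
    then show ?thesis unfolding Re_ray using t by simp
  qed
  have f1: "Re (f1 * cnj u) \<le> c" and f2: "Re (f2 * cnj u) \<le> c"
    using focus[of f1] focus[of f2] r by (auto simp: dist_commute)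
  have "f * cnj u = of_real (2 * c) * (u * cnj u) - cnj f1 * u * (u * cnj u)"
    unfolding f_def by (simp add: algebra_simps power2_eq_square)
  then have "f * cnj u = of_real (2 * c) - cnj (f1 * cnj u)" unfolding uu by simp
  \<comment> \<open>The mirror image of \<open>f1\<close> is on the far side while \<open>f2\<close>
    is on the near side, so the segment between them crosses the line.\<close>
  then have "Re (f * cnj u) \<ge> c" using f1 by simp
  moreover have "connected (closed_segment f2 f)" by simp
  ultimately obtain x where x: "x \<in> closed_segment f2 f" "Re (x * cnj u) = c"
    using connected_ivt_hyperplane[of "closed_segment f2 f" f2 f u c] f2
    unfolding inner by auto
  have "dist f2 f = dist f2 x + dist x f"
    using x(1) by (simp add: between_mem_segment[symmetric] between)
  then have "dist f2 f \<ge> 2 * r" using ge[OF x(2)] refl[OF x(2)] by (simp add: dist_commute)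
  moreover have "dist f2 f \<le> 2 * r"
    using e refl[OF e(2)] dist_triangle[of f2 f e] by (simp add: ellipse_def dist_commute)
  ultimately show ?thesis unfolding f_def by (simp add: dist_norm norm_minus_commute)
qed

text \<open>Squaring the tangency condition gives an equation which is quadratic in \<open>b\<close>; for fixed \<open>a\<close> its
  roots are the two vertices adjacent to \<open>a\<close>.\<close>

lemma tangent_chord_equation:
  fixes a b f1 f2 :: complex
  assumes a: "norm a = 1" and b: "norm b = 1"
    and tan: "norm (a + b - cnj f1 * (a * b) - f2) = 2 * r"
  shows "(1 - cnj f1 * a) * (1 - cnj f2 * a) * b\<^sup>2
     - (4 * r\<^sup>2 * a - (1 - cnj f1 * a) * (a - f1) - (1 - cnj f2 * a) * (a - f2)) * b
     + (a - f1) * (a - f2) = 0"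
proof -
  have aa: "a * cnj a = 1" and bb: "b * cnj b = 1" using a b by (simp_all add: complex_norm_square[symmetric])
  let ?w = "a + b - cnj f1 * (a * b) - f2"
  have "?w * cnj ?w = of_real ((2 * r)\<^sup>2)" using tan by (metis complex_norm_square)
  then have "?w * cnj ?w * (a * b) = 4 * r\<^sup>2 * (a * b)" by (simp add: power2_eq_square)
  moreover have "cnj ?w * (a * b) = (a * cnj a) * b + a * (b * cnj b) - f1 * (a * cnj a) * (b * cnj b) - cnj f2 * (a * b)"
    by (simp add: algebra_simps)
  then have "cnj ?w * (a * b) = b + a - f1 - cnj f2 * (a * b)"
    unfolding aa bb by simp
  ultimately have "?w * (b + a - f1 - cnj f2 * (a * b)) = 4 * r\<^sup>2 * (a * b)"
    by (metis mult.assoc)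
  then show ?thesis by (simp add: algebra_simps power2_eq_square)
qed

lemma cos_le_cos_of_between:
  assumes "0 \<le> d" "d \<le> x" "x \<le> 2 * pi - d" shows "cos x \<le> cos d"
proof (cases "x \<le> pi")
  case True then show ?thesis using assms by (intro cos_monotone_0_pi_le) auto
next
  case False
  have "cos (2 * pi - x) \<le> cos d" using assms False by (intro cos_monotone_0_pi_le) auto
  then show ?thesis by (simp add: cos_diff)
qed

section \<open>Sides of the Blaschke polygons as tangents\<close>

context circle_lift
begin

lemma norm_fib [simp]: "norm (fib j t) = 1"
  by (simp add: fib_def)

lemma fibre_representative:
  assumes "cis (h s) = cis (h t)"
  obtains j where "0 \<le> j" "j < int n" "cis s = fib j t"
proof -
  obtain i where i: "s = shift i t" using assms cis_h_eq_iff by blast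
  have "fib i t = fib (i mod int n) t" unfolding fib_eq_iff by (simp add: mod_eq_dvd_iff[symmetric])
  then show ?thesis using that[of "i mod int n"] i n_pos by (simp add: fib_def)
qed

text \<open>The chord from \<open>cis t\<close> to the next vertex is perpendicular to the midpoint
  direction \<open>u\<close> of its arc. The other vertices lie on the complementary arc, so the
  chord spans a supporting line and is a side; the ellipse lies on one side of that line and touches
  it.\<close>

lemma side_equation:
  assumes B: "\<And>t. B (cis t) = cis (h t)" and n: "n \<ge> 2" and r: "dist f1 f2 < 2 * r"
    and E: "\<And>w. norm w = 1 \<Longrightarrow> inscribed_in_polygon (ellipse f1 f2 r) (blaschke_vertices B w)"
  shows "norm (fib 0 t + fib 1 t - cnj f1 * (fib 0 t * fib 1 t) - f2) = 2 * r"
proof -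
  let ?S = "blaschke_vertices B (cis (h t))"
  define b where "b = shift 1 t"
  define d where "d = (b - t) / 2"
  define u where "u = cis ((t + b) / 2)"
  have tb: "t < b" using shift_less_iff[of 0 t 1] by (simp add: b_def)
  have bt: "b < t + 2 * pi" using shift_less_iff[of 1 t "int n"] shift_n_mult[of 1 t] n by (simp add: b_def)
  have Re: "Re (cis s * cnj u) = cos (s - (t + b) / 2)" for s
    unfolding u_def cis_cnj cis_mult by simp
  have ends: "Re (cis t * cnj u) = cos d" "Re (cis b * cnj u) = cos d"
  proof -
    have "t - (t + b) / 2 = - d" "b - (t + b) / 2 = d" by (simp_all add: d_def field_simps)
    then show "Re (cis t * cnj u) = cos d" "Re (cis b * cnj u) = cos d" unfolding Re by simp_all
  qed
  have S: "Re (z * cnj u) \<le> cos d" if z: "z \<in> ?S" for z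
  proof -
    have "z = cis (Arg z)" using z by (simp add: blaschke_vertices_def cis_Arg_unit)
    moreover have "B z = cis (h t)" using z by (simp add: blaschke_vertices_def)
    ultimately have "cis (h (Arg z)) = cis (h t)" using B by metis
    then obtain j where j: "0 \<le> j" "j < int n" "z = fib j t"
      using fibre_representative \<open>z = cis (Arg z)\<close> by metis
    show ?thesis
    proof (cases "j = 0")
      case True then show ?thesis using ends(1) j by (simp add: fib_def)
    next
      case False
      \<comment> \<open>Indices strictly between \<open>0\<close> and \<open>n\<close> land between
        \<open>b\<close> and \<open>t + 2 * pi\<close>, so their angle from the midpoint direction
        is between \<open>d\<close> and \<open>2 * pi - d\<close>.\<close>
      have "b \<le> shift j t" using shift_less_iff[of j t 1] j False by (simp add: b_def not_less[symmetric])
      moreover have "shift j t < t + 2 * pi" using shift_less_iff[of j t "int n"] shift_n_mult[of 1 t] j by simp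
      ultimately have "cos (shift j t - (t + b) / 2) \<le> cos d"
        using tb by (intro cos_le_cos_of_between) (auto simp: d_def field_simps)
      then show ?thesis unfolding j(3) fib_def Re .
    qed
  qed
  have u1: "norm u = 1" by (simp add: u_def)
  have aS: "cis t \<in> ?S" and bS: "cis b \<in> ?S"
    using B cis_h_eq_iff[of b t] by (auto simp: blaschke_vertices_def b_def)
  note line = segment_frontier_of_supporting_line[OF u1 S aS bS ends]
  have insc: "inscribed_in_polygon (ellipse f1 f2 r) ?S" using E by simp
  have "cis t \<noteq> cis b"
    using fib_eq_iff[of 1 t 0] n by (auto simp: fib_def b_def)
  then have "closed_segment (cis t) (cis b) \<inter> ellipse f1 f2 r \<noteq> {}"
    using insc line(2) aS bS unfolding inscribed_in_polygon_def by blast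
  then obtain e where "e \<in> ellipse f1 f2 r" "Re (e * cnj u) = cos d" using line(3) by blast
  moreover have "ellipse f1 f2 r \<subseteq> {z. Re (z * cnj u) \<le> cos d}"
    using insc line(1) unfolding inscribed_in_polygon_def by blast
  ultimately have "norm (of_real (2 * cos d) * u - cnj f1 * u\<^sup>2 - f2) = 2 * r"
    using ellipse_tangent_line[OF u1 r] by blast
  moreover have "u\<^sup>2 = cis t * cis b" unfolding u_def power2_eq_square cis_mult by simp
  moreover have "of_real (2 * cos d) * u = cis t + cis b"
  proof -
    have "of_real (2 * cos d) = cis d + cis (- d)" by (simp add: complex_eq_iff)
    moreover have "d + (t + b) / 2 = b" "- d + (t + b) / 2 = t" by (simp_all add: d_def field_simps)
    ultimately show ?thesis by (simp add: u_def cis_mult distrib_right)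
  qed
  ultimately show ?thesis by (simp add: fib_def b_def)
qed

text \<open>This keeps the leading coefficient of the tangency quadratic from vanishing on the
  closed disc.\<close>

lemma ellipse_foci_in_disc:
  assumes E: "inscribed_in_polygon (ellipse f1 f2 r) (blaschke_vertices B w)" and r: "dist f1 f2 < 2 * r"
  shows "norm f1 < 1" "norm f2 < 1"
proof -
  have "blaschke_vertices B w \<subseteq> cball 0 1" by (auto simp: blaschke_vertices_def)
  then have "convex hull blaschke_vertices B w \<subseteq> cball 0 1" by (rule hull_minimal) simp
  then have E': "ellipse f1 f2 r \<subseteq> cball 0 1" using E unfolding inscribed_in_polygon_def by blast
  show "norm f1 < 1" by (rule ellipse_focus_in_disc[OF r E'])
  show "norm f2 < 1" by (rule ellipse_focus_in_disc[of f2 f1 r])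
      (use r E' in \<open>auto simp: dist_commute ellipse_commute[of f2]\<close>)
qed

end

section \<open>Symmetric functions of the vertices\<close>

text \<open>Newton's recursion for \<open>u ^ l + v ^ l\<close> in terms of \<open>s = u + v\<close>
  and \<open>p = u * v\<close>.\<close>

fun power_sum :: "nat \<Rightarrow> complex \<Rightarrow> complex \<Rightarrow> complex" where
  "power_sum 0 s p = 2"
| "power_sum (Suc 0) s p = s"
| "power_sum (Suc (Suc l)) s p = s * power_sum (Suc l) s p - p * power_sum l s p"

lemma power_sum_eq: "power_sum l (u + v) (u * v) = u ^ l + v ^ l"
  by (induction l "u + v" "u * v" rule: power_sum.induct) (simp_all add: algebra_simps)

lemma power_sum_in_disc_algebra:
  "s \<in> disc_algebra \<Longrightarrow> p \<in> disc_algebra \<Longrightarrow> (\<lambda>z. power_sum l (s z) (p z)) \<in> disc_algebra"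
  by (induction l rule: induct_nat_012) (auto intro: disc_algebra_intros)

text \<open>The maximum principle bounds all power sums of the two roots by \<open>2\<close> throughout the disc,
  so neither root can leave it.\<close>

lemma root_norm_le_1:
  assumes A: "s \<in> disc_algebra" "p \<in> disc_algebra"
    and bd: "\<And>z. norm z = 1 \<Longrightarrow> \<exists>u v. norm u = 1 \<and> norm v = 1 \<and> s z = u + v \<and> p z = u * v"
    and z: "norm z \<le> 1" and uv: "s z = u + v" "p z = u * v"
  shows "norm u \<le> 1"
proof (rule ccontr)
  assume "\<not> norm u \<le> 1"
  then obtain l where l: "norm u ^ l > 3" using real_arch_pow[of "norm u" 3] by auto
  have "norm (power_sum l (s z) (p z)) \<le> 2"
  proof (rule disc_algebra_norm_le[OF power_sum_in_disc_algebra[OF A] _ z])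
    fix w :: complex assume "norm w = 1"
    then obtain u v where "norm u = 1" "norm v = 1" "s w = u + v" "p w = u * v" using bd by blast
    then show "norm (power_sum l (s w) (p w)) \<le> 2"
      using norm_triangle_ineq[of "u ^ l" "v ^ l"] by (simp add: power_sum_eq norm_power)
  qed
  then have sum: "norm (u ^ l + v ^ l) \<le> 2" by (simp add: uv power_sum_eq)
  have "norm (p z) \<le> 1"
    by (rule disc_algebra_norm_le[OF A(2) _ z]) (use bd in \<open>force simp: norm_mult\<close>)
  then have prod: "norm (u ^ l * v ^ l) \<le> 1"
    by (simp add: uv norm_power power_le_one flip: power_mult_distrib)
  define x where "x = norm (u ^ l)"
  \<comment> \<open>\<open>u ^ l\<close> is a root of the quadratic with this sum and product; the
    bounds give \<open>x * x \<le> 2 * x + 1\<close>, impossible for \<open>x > 3\<close>.\<close>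
  have "u ^ l * u ^ l = u ^ l * (u ^ l + v ^ l) - u ^ l * v ^ l" by (simp add: algebra_simps)
  then have "x * x \<le> x * norm (u ^ l + v ^ l) + norm (u ^ l * v ^ l)"
    unfolding x_def by (metis norm_mult norm_triangle_ineq4)
  also have "\<dots> \<le> x * 2 + 1"
    by (intro add_mono mult_left_mono sum prod) (simp add: x_def)
  finally have "x * (x - 2) \<le> 1" by (simp add: algebra_simps)
  moreover have "x > 3" using l by (simp add: x_def norm_power)
  then have "3 * 1 < x * (x - 2)" by (intro mult_strict_mono) auto
  ultimately show False by simp
qed

fun quad :: "complex \<times> complex \<times> complex \<Rightarrow> complex \<Rightarrow> complex" where
  "quad (a, b, c) z = a + b * z + c * z\<^sup>2"

text \<open>The polarised product \<open>quad f u * quad g v + quad f v * quad g u\<close>, written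
  in the elementary symmetric functions of \<open>u\<close> and \<open>v\<close>.\<close>

fun sym_quad :: "complex \<times> complex \<times> complex \<Rightarrow> complex \<times> complex \<times> complex
    \<Rightarrow> complex \<Rightarrow> complex \<Rightarrow> complex" where
  "sym_quad (a, b, c) (a', b', c') s p = 2 * a * a' + (a * b' + b * a') * s
     + (a * c' + c * a') * (s\<^sup>2 - 2 * p) + 2 * b * b' * p + (b * c' + c * b') * (p * s)
     + 2 * c * c' * p\<^sup>2"

lemma sym_quad_eq: "sym_quad f g (u + v) (u * v) = quad f u * quad g v + quad f v * quad g u"
  by (cases f; cases g) (simp add: algebra_simps power2_eq_square)

lemma sym_quad_in_disc_algebra:
  "s \<in> disc_algebra \<Longrightarrow> p \<in> disc_algebra \<Longrightarrow> (\<lambda>z. sym_quad f g (s z) (p z)) \<in> disc_algebra"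
  by (cases f; cases g) (simp, intro disc_algebra_intros, assumption+)

lemma sum_product_complex_ex:
  fixes s p :: complex obtains u v where "s = u + v" "p = u * v"
proof -
  let ?d = "csqrt (s\<^sup>2 - 4 * p)"
  have "(s + ?d) / 2 * ((s - ?d) / 2) = (s\<^sup>2 - ?d\<^sup>2) / 4"
    by (simp add: field_simps power2_eq_square)
  then show ?thesis using that[of "(s + ?d) / 2" "(s - ?d) / 2"] by (simp add: field_simps)
qed

text \<open>Sum and product of the values of a rational function at two roots are quotients of
  polynomials in \<open>s\<close> and \<open>p\<close>. The denominator is a multiple of
  \<open>quad g u * quad g v\<close>, which cannot vanish since both roots stay in the closed
  disc.\<close>

lemma symmetric_rational_in_disc_algebra:
  assumes A: "s \<in> disc_algebra" "p \<in> disc_algebra"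
    and bd: "\<And>z. norm z = 1 \<Longrightarrow> \<exists>u v. norm u = 1 \<and> norm v = 1 \<and> s z = u + v \<and> p z = u * v"
    and nz: "\<And>u. norm u \<le> 1 \<Longrightarrow> quad g u \<noteq> 0"
  shows "\<exists>F\<in>disc_algebra. \<exists>G\<in>disc_algebra. \<forall>z u v. norm z \<le> 1 \<longrightarrow> s z = u + v \<longrightarrow> p z = u * v \<longrightarrow>
    F z = quad f u / quad g u + quad f v / quad g v \<and>
    G z = (quad f u / quad g u) * (quad f v / quad g v)"
proof -
  define N where "N f f' z = sym_quad f f' (s z) (p z)" for f f' z
  have N: "N f f' \<in> disc_algebra" for f f'
    unfolding N_def[abs_def] by (rule sym_quad_in_disc_algebra[OF A])
  have nz': "quad g u \<noteq> 0" "quad g v \<noteq> 0" if "norm z \<le> 1" "s z = u + v" "p z = u * v" for z u v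
    using root_norm_le_1[OF A bd that(1), of u v] root_norm_le_1[OF A bd that(1), of v u] that nz
    by (auto simp: ac_simps)
  have Nnz: "N g g z \<noteq> 0" if z: "norm z \<le> 1" for z
  proof -
    obtain u v where uv: "s z = u + v" "p z = u * v" using sum_product_complex_ex by blast
    then show ?thesis using nz'[OF z uv] by (simp add: N_def sym_quad_eq)
  qed
  show ?thesis
  \<comment> \<open>\<open>N g g\<close> is twice \<open>quad g u * quad g v\<close>, while
    \<open>N f g\<close> is the full numerator of the sum, hence the factor two; in the product the
    twos cancel.\<close>
  proof (rule bexI[of _ "\<lambda>z. 2 * N f g z / N g g z"], rule bexI[of _ "\<lambda>z. N f f z / N g g z"],
      intro allI impI conjI)
    show "(\<lambda>z. 2 * N f g z / N g g z) \<in> disc_algebra" "(\<lambda>z. N f f z / N g g z) \<in> disc_algebra"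
      by (intro disc_algebra_intros N Nnz; assumption)+
    fix z u v :: complex assume z: "norm z \<le> 1" and uv: "s z = u + v" "p z = u * v"
    note nz'[OF z uv]
    then show "2 * N f g z / N g g z = quad f u / quad g u + quad f v / quad g v"
      and "N f f z / N g g z = (quad f u / quad g u) * (quad f v / quad g v)"
      by (simp_all add: N_def uv sym_quad_eq field_simps)
  qed
qed

lemma prod_symmetric_int_interval:
  fixes F :: "int \<Rightarrow> 'a::comm_monoid_mult"
  shows "(\<Prod>l\<in>{- int q..int q}. F l) = F 0 * (\<Prod>i\<in>{1..q}. F (int i) * F (- int i))"
proof (induction q)
  case (Suc q)
  have "{- int (Suc q)..int (Suc q)} = insert (- int (Suc q)) (insert (int (Suc q)) {- int q..int q})"
    by auto
  then show ?case using Suc by (simp add: mult_ac)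
qed simp

lemma prod_period_shift:
  fixes F :: "int \<Rightarrow> 'a::comm_monoid_mult"
  assumes "F (a + int m) = F a" and "m > 0"
  shows "(\<Prod>l\<in>{a..<a + int m}. F (l + 1)) = (\<Prod>l\<in>{a..<a + int m}. F l)"
proof -
  have "(\<Prod>l\<in>{a..<a + int m}. F (l + 1)) = (\<Prod>l\<in>{a + 1..<a + int m + 1}. F l)"
    by (rule prod.reindex_bij_witness[of _ "\<lambda>l. l - 1" "\<lambda>l. l + 1"]) auto
  also have "{a + 1..<a + int m + 1} = insert (a + int m) {a + 1..<a + int m}"
    using assms(2) by auto
  also have "(\<Prod>l\<in>insert (a + int m) {a + 1..<a + int m}. F l) = (\<Prod>l\<in>insert a {a + 1..<a + int m}. F l)"
    using assms(1) by simp
  also have "insert a {a + 1..<a + int m} = {a..<a + int m}" using assms(2) by auto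
  finally show ?thesis .
qed

section \<open>Iteration along the fibre and the inner factor\<close>

context circle_lift
begin

lemma fib_shift: "fib i (shift j t) = fib (i + j) t"
  by (simp add: fib_def shift_shift)

lemma cis_shift: "cis (shift j t) = fib j t"
  by (simp add: fib_def)

text \<open>The pair is recorded through its sum and product because the two points need not extend
  to the disc separately.\<close>

definition extends_pair :: "int \<Rightarrow> (complex \<Rightarrow> complex) \<Rightarrow> (complex \<Rightarrow> complex) \<Rightarrow> bool" where
  "extends_pair j s p \<longleftrightarrow> s \<in> disc_algebra \<and> p \<in> disc_algebra \<and>
     (\<forall>t. s (cis t) = fib j t + fib (- j) t \<and> p (cis t) = fib j t * fib (- j) t)"

text \<open>The neighbours of \<open>fib j t\<close> and \<open>fib (- j) t\<close> are the pairs of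
  index \<open>j + 1\<close> and \<open>j - 1\<close>. The first two elementary symmetric functions
  of these four points extend, and removing the known inner pair leaves the outer one.\<close>

lemma extends_pair_step:
  assumes sum: "\<And>t. quad f (cis t) = quad g (cis t) * (fib 1 t + fib (- 1) t)"
    and prod: "\<And>t. quad f' (cis t) = quad g (cis t) * (fib 1 t * fib (- 1) t)"
    and nz: "\<And>u. norm u \<le> 1 \<Longrightarrow> quad g u \<noteq> 0"
    and ext: "extends_pair j s p" "extends_pair (j - 1) s' p'"
  obtains s'' p'' where "extends_pair (j + 1) s'' p''"
proof -
  have A: "s \<in> disc_algebra" "p \<in> disc_algebra" "s' \<in> disc_algebra" "p' \<in> disc_algebra"
    using ext by (auto simp: extends_pair_def)
  have at: "s (cis t) = fib j t + fib (- j) t" "p (cis t) = fib j t * fib (- j) t"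
     "s' (cis t) = fib (j - 1) t + fib (1 - j) t" "p' (cis t) = fib (j - 1) t * fib (1 - j) t" for t
    using ext by (auto simp: extends_pair_def)
  have bd: "\<exists>u v. norm u = 1 \<and> norm v = 1 \<and> s z = u + v \<and> p z = u * v" if "norm z = 1" for z
  proof -
    have "z = cis (Arg z)" using that by (simp add: cis_Arg_unit)
    then show ?thesis using at(1,2)[of "Arg z"] norm_fib by metis
  qed
  obtain F G where FG: "F \<in> disc_algebra" "G \<in> disc_algebra"
    "\<And>z u v. norm z \<le> 1 \<Longrightarrow> s z = u + v \<Longrightarrow> p z = u * v \<Longrightarrow> F z = quad f u / quad g u + quad f v / quad g v"
    "\<And>z u v. norm z \<le> 1 \<Longrightarrow> s z = u + v \<Longrightarrow> p z = u * v \<Longrightarrow> G z = (quad f u / quad g u) * (quad f v / quad g v)"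
    using symmetric_rational_in_disc_algebra[OF A(1,2) bd nz, where f = f] by blast
  obtain F' where F': "F' \<in> disc_algebra"
    "\<And>z u v. norm z \<le> 1 \<Longrightarrow> s z = u + v \<Longrightarrow> p z = u * v \<Longrightarrow> F' z = quad f' u / quad g u + quad f' v / quad g v"
    using symmetric_rational_in_disc_algebra[OF A(1,2) bd nz, where f = f'] by blast
  have q: "quad f (fib i t) / quad g (fib i t) = fib (i + 1) t + fib (i - 1) t"
          "quad f' (fib i t) / quad g (fib i t) = fib (i + 1) t * fib (i - 1) t" for i t
    using sum[of "shift i t"] prod[of "shift i t"] nz[of "fib i t"]
    by (simp_all add: cis_shift fib_shift add.commute[of _ i])
  define s'' where "s'' z = F z - s' z" for z
  \<comment> \<open>\<open>F' + G\<close> is the second elementary symmetric function of the four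
    neighbours. Taking away the inner product and the mixed products of inner and outer points
    leaves the outer product.\<close>
  define p'' where "p'' z = F' z + G z - p' z - s'' z * s' z" for z
  have le: "norm (cis t) \<le> 1" for t by simp
  have s'': "s'' (cis t) = fib (j + 1) t + fib (- (j + 1)) t" for t
    unfolding s''_def FG(3)[OF le at(1,2)] q at by simp
  have e: "- j - 1 = - (j + 1)" "- j + 1 = 1 - j" by simp_all
  have p'': "p'' (cis t) = fib (j + 1) t * fib (- (j + 1)) t" for t
    unfolding p''_def FG(4)[OF le at(1,2)] F'(2)[OF le at(1,2)] q at s'' e
    by (simp add: algebra_simps)
  have sA: "s'' \<in> disc_algebra" unfolding s''_def[abs_def] by (intro disc_algebra_intros FG A)
  then have "p'' \<in> disc_algebra" unfolding p''_def[abs_def] by (intro disc_algebra_intros FG F' A)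
  with sA s'' p'' have "extends_pair (j + 1) s'' p''" by (simp add: extends_pair_def)
  then show ?thesis by (rule that)
qed

text \<open>The recursion has order two, so the induction carries two consecutive indices; at index
  \<open>0\<close> the pair is a double point.\<close>

lemma extends_pair_ex:
  assumes sum: "\<And>t. quad f (cis t) = quad g (cis t) * (fib 1 t + fib (- 1) t)"
    and prod: "\<And>t. quad f' (cis t) = quad g (cis t) * (fib 1 t * fib (- 1) t)"
    and nz: "\<And>u. norm u \<le> 1 \<Longrightarrow> quad g u \<noteq> 0"
  shows "\<exists>s p. extends_pair (int j) s p"
proof -
  have quadA: "quad f \<in> disc_algebra" for f
    unfolding disc_algebra_def
    by (cases f) (auto simp: quad.simps[abs_def] intro!: continuous_intros holomorphic_intros)
  have 0: "extends_pair 0 (\<lambda>z. 2 * z) (\<lambda>z. z * z)"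
    by (auto simp: extends_pair_def fib_def intro!: disc_algebra_intros)
  have 1: "extends_pair 1 (\<lambda>z. quad f z / quad g z) (\<lambda>z. quad f' z / quad g z)"
    using sum prod nz by (auto simp: extends_pair_def intro!: disc_algebra_intros quadA)
  have "\<exists>s p s' p'. extends_pair (int j) s p \<and> extends_pair (int j + 1) s' p'"
  proof (induction j)
    case 0
    show ?case using \<open>extends_pair 0 _ _\<close> 1 by auto
  next
    case (Suc j)
    then obtain s p s' p' where sp: "extends_pair (int j) s p" "extends_pair (int j + 1) s' p'" by blast
    obtain s'' p'' where "extends_pair (int j + 1 + 1) s'' p''"
      using extends_pair_step[OF sum prod nz, of "int j + 1" s' p' s p] sp by auto
    then show ?case using sp(2) by (auto simp: add_ac)
  qed
  then show ?thesis by blast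
qed

text \<open>A period of \<open>m\<close> indices around \<open>0\<close> splits into opposite pairs
  \<open>l\<close>, \<open>- l\<close>, whose products extend, the index \<open>0\<close> and, for
  even \<open>m\<close>, one index that is its own opposite modulo \<open>m\<close>.\<close>

lemma fibre_product_extends:
  assumes ext: "\<And>j. \<exists>s p. extends_pair (int j) s p" and n: "n = k * m" and m: "m > 0"
  obtains D a where "D \<in> disc_algebra"
    "\<And>t. D (cis t) = (\<Prod>l\<in>{a..<a + int m}. fib (int k * l) t)"
proof -
  from ext obtain s p where sp: "\<And>j. extends_pair (int j) (s j) (p j)" by metis
  \<comment> \<open>The number of opposite pairs: \<open>m\<close> is \<open>2 * q + 1\<close> or
    \<open>2 * q + 2\<close>.\<close>
  define q where "q = (m - 1) div 2"
  define D0 where "D0 z = z * (\<Prod>i\<in>{1..q}. p (k * i) z)" for z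
  have pA: "p j \<in> disc_algebra" and sA: "s j \<in> disc_algebra" for j
    using sp[of j] by (auto simp: extends_pair_def)
  have D0A: "D0 \<in> disc_algebra" unfolding D0_def[abs_def] by (intro disc_algebra_intros pA)
  have D0: "D0 (cis t) = (\<Prod>l\<in>{- int q..int q}. fib (int k * l) t)" for t
  proof -
    have "p (k * i) (cis t) = fib (int k * int i) t * fib (int k * - int i) t" for i
      using sp[of "k * i"] by (simp add: extends_pair_def)
    then show ?thesis unfolding prod_symmetric_int_interval D0_def by (simp add: fib_def)
  qed
  show ?thesis
  proof (cases "odd m")
    case True
    then have "{- int q..int q} = {- int q..<- int q + int m}"
      using m by (auto simp: q_def elim!: oddE)
    then show ?thesis using that[OF D0A] D0 by metis
  next
    case False
    \<comment> \<open>The two points of this pair are \<open>n\<close> steps apart, hence equal, so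
      half of their sum is the missing factor.\<close>
    define D where "D z = D0 z * (s (k * (q + 1)) z / 2)" for z
    have m2: "m = 2 * (q + 1)" using False m by (auto simp: q_def elim!: evenE)
    have "s (k * (q + 1)) (cis t) / 2 = fib (int k * int (q + 1)) t" for t
    proof -
      have "int (k * (q + 1)) - (- int (k * (q + 1))) = int n" unfolding n m2 by simp
      then have "fib (int (k * (q + 1))) t = fib (- int (k * (q + 1))) t"
        unfolding fib_eq_iff by simp
      then have s: "s (k * (q + 1)) (cis t) = 2 * fib (int (k * (q + 1))) t"
        using sp[of "k * (q + 1)"] unfolding extends_pair_def by simp
      have e: "int k * int (q + 1) = int (k * (q + 1))" by (simp only: of_nat_mult)
      show ?thesis unfolding e s by simp
    qed
    moreover have "{- int q..<- int q + int m} = insert (int (q + 1)) {- int q..int q}"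
      unfolding m2 by auto
    ultimately have "D (cis t) = (\<Prod>l\<in>{- int q..<- int q + int m}. fib (int k * l) t)" for t
      unfolding D_def D0 by (simp add: mult.commute)
    moreover have "D \<in> disc_algebra" unfolding D_def[abs_def]
      by (intro disc_algebra_intros D0A sA) auto
    ultimately show ?thesis using that by blast
  qed
qed

text \<open>Moving \<open>k\<close> steps permutes the \<open>m\<close> factors cyclically. Each
  factor turns once when \<open>t\<close> grows by \<open>2 * pi\<close>, so the degree is
  \<open>m\<close>.\<close>

lemma invariant_blaschke_ex:
  assumes ext: "\<And>j. \<exists>s p. extends_pair (int j) s p" and n: "n = k * m" and m: "m > 0"
  obtains D where "blaschke m D" "\<And>t. D (cis (shift (int k) t)) = D (cis t)"
proof -
  obtain D a where DA: "D \<in> disc_algebra"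
    and D: "\<And>t. D (cis t) = (\<Prod>l\<in>{a..<a + int m}. fib (int k * l) t)"
    using fibre_product_extends[OF ext n m] by metis
  have uni: "norm (D z) = 1" if "norm z = 1" for z
  proof -
    have "z = cis (Arg z)" using that by (simp add: cis_Arg_unit)
    then show ?thesis using D[of "Arg z"] by (simp flip: prod_norm)
  qed
  have inv: "D (cis (shift (int k) t)) = D (cis t)" for t
  proof -
    have "fib (int k * (a + int m)) t = fib (int k * a) t"
      unfolding fib_eq_iff n by (simp add: algebra_simps)
    from prod_period_shift[of "\<lambda>l. fib (int k * l) t", OF this m]
    show ?thesis unfolding D fib_shift by (simp add: algebra_simps)
  qed
  obtain d b where b: "blaschke d b" "\<And>z. norm z \<le> 1 \<Longrightarrow> D z = b z"
    using blaschke_of_unimodular[OF DA uni] by metis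
  obtain g where g: "continuous_on UNIV g" "\<And>t. b (cis t) = cis (g t)"
    "\<And>t. g (t + 2 * pi) = g t + 2 * pi * real d"
    using blaschke_lift[OF b(1)] by metis
  define g' where "g' t = (\<Sum>l\<in>{a..<a + int m}. shift (int k * l) t)" for t
  have "(\<Prod>l\<in>L. cis (x l)) = cis (\<Sum>l\<in>L. x l)" if "finite L" for L and x :: "int \<Rightarrow> real"
    using that by (induction L) (auto simp: cis_mult)
  then have "cis (g t) = cis (g' t)" for t
    using b(2)[of "cis t"] g(2)[of t] D[of t] by (simp add: g'_def fib_def)
  moreover have "g' (t + 2 * pi) = g' t + 2 * pi * real m" for t
    by (simp add: g'_def shift_add_period sum.distrib)
  moreover have "continuous_on UNIV g'"
    unfolding g'_def by (intro continuous_intros continuous_shift)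
  ultimately have "real d = real m" using lift_degree_unique[of g g'] g by metis
  then show ?thesis using that[of b] b inv by simp
qed

end

section \<open>The left factor\<close>

lemma norm_blaschke_less:
  assumes "blaschke n B" "n > 0" "norm z < 1" shows "norm (B z) < 1"
proof -
  obtain \<gamma> a where \<gamma>: "norm \<gamma> = 1" and a: "\<forall>j<n. norm (a j) < 1"
    and B: "\<And>z. B z = \<gamma> * (\<Prod>j<n. blaschke_factor (a j) z)"
    using assms unfolding blaschke_def blaschke_factor_def by blast
  obtain l where l: "n = Suc l" using assms(2) gr0_implies_Suc by blast
  have f: "norm (blaschke_factor (a j) z) < 1" if "j < n" for j
    using a assms(3) that by (intro norm_blaschke_factor_less) auto
  have "norm (\<Prod>j<l. blaschke_factor (a j) z) \<le> 1"
    unfolding prod_norm[symmetric] using f l by (intro prod_le_1) (auto intro: less_imp_le)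
  then have "norm (\<Prod>j<n. blaschke_factor (a j) z) \<le> 1 * norm (blaschke_factor (a l) z)"
    unfolding l prod.lessThan_Suc norm_mult by (intro mult_right_mono) auto
  then show ?thesis using f[of l] l \<gamma> unfolding B norm_mult by simp
qed

lemma blaschke_quotient_polys:
  assumes "blaschke n B"
  obtains p q where "degree p \<le> n" "degree q \<le> n"
    "\<And>z. norm z \<le> 1 \<Longrightarrow> poly q z \<noteq> 0" "\<And>z. norm z \<le> 1 \<Longrightarrow> B z * poly q z = poly p z"
proof -
  obtain \<gamma> a where a: "\<forall>j<n. norm (a j) < 1"
    and B: "\<And>z. B z = \<gamma> * (\<Prod>j<n. (z - a j) / (1 - cnj (a j) * z))"
    using assms unfolding blaschke_def by blast
  define p where "p = smult \<gamma> (\<Prod>j<n. [:- a j, 1:])"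
  define q where "q = (\<Prod>j<n. [:1, - cnj (a j):])"
  have deg: "degree (\<Prod>j<n. [:b j, c j:]) \<le> n" for b c :: "nat \<Rightarrow> complex"
    using degree_prod_sum_le[of "{..<n}" "\<lambda>j. [:b j, c j:]"]
      sum_bounded_above[of "{..<n}" "\<lambda>j. degree [:b j, c j:]" 1] by (simp add: le_trans)
  have q: "poly q z = (\<Prod>j<n. 1 - cnj (a j) * z)" for z
    by (simp add: q_def poly_prod mult.commute)
  have nz: "poly q z \<noteq> 0" if "norm z \<le> 1" for z
    unfolding q using a blaschke_denom_nz that by auto
  show ?thesis
  proof (rule that[of p q])
    show "degree p \<le> n" unfolding p_def by (rule order_trans[OF degree_smult_le deg])
    show "degree q \<le> n" unfolding q_def by (rule deg)
    show "B z * poly q z = poly p z" if "norm z \<le> 1" for z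
      using nz[OF that] unfolding B prod_dividef q by (simp add: p_def poly_prod)
  qed (rule nz)
qed

text \<open>On the circle this is surjectivity of the lift. If an interior value \<open>u\<close>
  were omitted, \<open>D\<close> followed by the Blaschke factor of \<open>u\<close> would be
  zero-free and unimodular, hence a constant \<open>c\<close>; points where \<open>D\<close> is
  \<open>1\<close> and \<open>- 1\<close> then give \<open>u = - c\<close>, of modulus one.\<close>

lemma blaschke_surj:
  assumes D: "blaschke m D" and m: "m > 0" and u: "norm u \<le> 1"
  obtains z where "norm z \<le> 1" "D z = u" "norm u = 1 \<Longrightarrow> norm z = 1"
proof -
  obtain g where g: "continuous_on UNIV g" "\<And>t. D (cis t) = cis (g t)"
    "\<And>t. g (t + 2 * pi) = g t + 2 * pi * real m" "strict_mono g"
    using blaschke_lift[OF D] m by metis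
  interpret circle_lift m g by unfold_locales (use g m in auto)
  have circ: "\<exists>z. norm z = 1 \<and> D z = w" if "norm w = 1" for w
  proof -
    have "w = cis (Arg w)" using that by (simp add: cis_Arg_unit)
    moreover obtain t where "g t = Arg w" using surj by (metis surjD)
    ultimately show ?thesis using g(2)[of t] by (intro exI[of _ "cis t"]) simp
  qed
  show ?thesis
  proof (cases "norm u = 1")
    case True then show ?thesis using circ[of u] that by auto
  next
    case False
    with u have u1: "norm u < 1" by simp
    have DA: "D \<in> disc_algebra" by (rule blaschke_in_disc_algebra[OF D])
    have le: "norm (D z) \<le> 1" if "norm z \<le> 1" for z
      by (rule disc_algebra_norm_le[OF DA _ that]) (simp add: norm_blaschke_eq[OF D])
    have "\<exists>z. norm z < 1 \<and> D z = u"
    proof (rule ccontr)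
      assume no: "\<nexists>z. norm z < 1 \<and> D z = u"
      let ?f = "\<lambda>z. (D z - u) / (1 - cnj u * D z)"
      have den: "1 - cnj u * D z \<noteq> 0" if "norm z \<le> 1" for z
        using blaschke_denom_nz[OF u1 le[OF that]] .
      have "?f \<in> disc_algebra" by (intro disc_algebra_intros DA den)
      moreover have "norm (?f z) = 1" if "norm z = 1" for z
        using norm_blaschke_factor_eq[OF u1 norm_blaschke_eq[OF D that]] by (simp add: blaschke_factor_def)
      moreover have "?f z \<noteq> 0" if "norm z < 1" for z using no den[of z] that by auto
      ultimately obtain c where c: "norm c = 1" "\<And>z. norm z \<le> 1 \<Longrightarrow> ?f z = c"
        using disc_algebra_zero_free_const[of ?f] by blast
      obtain z1 z2 where z: "norm z1 = 1" "D z1 = 1" "norm z2 = 1" "D z2 = - 1"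
        using circ[of 1] circ[of "- 1"] by auto
      have e: "1 - u = c * (1 - cnj u)" "- 1 - u = c * (1 + cnj u)"
        using c(2)[of z1] c(2)[of z2] den[of z1] den[of z2] z by (simp_all add: field_simps)
      have "(1 - u) + (- 1 - u) = c * (1 - cnj u) + c * (1 + cnj u)" unfolding e ..
      then have "- u = c" by (simp add: algebra_simps)
      then have "u = - c" by auto
      then show False using c(1) u1 by simp
    qed
    then show ?thesis using that False by (metis less_imp_le)
  qed
qed

context circle_lift
begin

text \<open>Both sides of the resulting identity are polynomials of degree at most \<open>n\<close> which vanish on the
  \<open>n\<close> points of the fibre of \<open>B\<close> over \<open>w\<close>.\<close>

lemma fibre_polynomial:
  assumes B: "\<And>t. B (cis t) = cis (h t)"
    and D: "blaschke m D" "\<And>t. D (cis (shift (int k) t)) = D (cis t)" and n: "n = k * m"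
    and pq: "degree p \<le> n" "degree q \<le> n" "\<And>z. norm z \<le> 1 \<Longrightarrow> poly q z \<noteq> 0"
        "\<And>z. norm z \<le> 1 \<Longrightarrow> B z * poly q z = poly p z"
    and PQ: "degree P \<le> m" "degree Q \<le> m" "\<And>z. norm z \<le> 1 \<Longrightarrow> poly Q z \<noteq> 0"
        "\<And>z. norm z \<le> 1 \<Longrightarrow> D z * poly Q z = poly P z"
    and w: "norm w = 1" and B0: "norm (B 0) < 1"
  obtains c \<mu> where "c \<noteq> 0"
    "\<And>z. norm z \<le> 1 \<Longrightarrow> c * (\<Prod>i<k. D z - \<mu> i) * poly Q z ^ k = (B z - w) * poly q z"
proof -
  have "w = cis (Arg w)" using w by (simp add: cis_Arg_unit)
  moreover obtain t where "h t = Arg w" using surj by (metis surjD)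
  ultimately have t: "cis (h t) = w" by simp
  have m0: "m > 0" and k0: "k > 0" using n n_pos by auto
  \<comment> \<open>By invariance, \<open>D\<close> takes on the whole fibre only its values at the
    first \<open>k\<close> points.\<close>
  define \<mu> where "\<mu> i = D (fib (int i) t)" for i :: nat
  define R where "R = (\<Prod>i<k. P - smult (\<mu> i) Q)"
  define S where "S = p - smult w q"
  have R: "poly R z = (\<Prod>i<k. D z - \<mu> i) * poly Q z ^ k" if "norm z \<le> 1" for z
  proof -
    have "poly (P - smult (\<mu> i) Q) z = (D z - \<mu> i) * poly Q z" for i
      using PQ(4)[OF that] by (simp add: left_diff_distrib)
    then show ?thesis by (simp add: R_def poly_prod prod.distrib del: poly_diff poly_smult)
  qed
  have S: "poly S z = (B z - w) * poly q z" if "norm z \<le> 1" for z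
    using pq(4)[OF that] by (simp add: S_def left_diff_distrib)
  have degR: "degree R \<le> n"
  proof -
    have "degree (P - smult (\<mu> i) Q) \<le> m" for i
      using PQ(1,2) degree_smult_le[of "\<mu> i" Q] by (intro degree_diff_le) auto
    then have "(\<Sum>i<k. degree (P - smult (\<mu> i) Q)) \<le> of_nat (card {..<k}) * m"
      by (intro sum_bounded_above) auto
    moreover have "degree R \<le> (\<Sum>i<k. degree (P - smult (\<mu> i) Q))"
      using degree_prod_sum_le[of "{..<k}" "\<lambda>i. P - smult (\<mu> i) Q"] by (simp add: R_def o_def)
    ultimately show ?thesis by (simp add: n)
  qed
  have degS: "degree S \<le> n"
    unfolding S_def using pq(1,2) degree_smult_le[of w q] by (intro degree_diff_le) auto
  define X where "X = (\<lambda>j. fib (int j) t) ` {..<n}"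
  have inj: "inj_on (\<lambda>j. fib (int j) t) {..<n}"
  proof (rule inj_onI)
    fix i j assume ij: "i \<in> {..<n}" "j \<in> {..<n}" "fib (int i) t = fib (int j) t"
    then have "int i mod int n = int j mod int n" by (simp only: fib_eq_iff mod_eq_dvd_iff)
    then show "i = j" using ij by (metis lessThan_iff mod_less of_nat_eq_iff zmod_int)
  qed
  have D_per: "D (fib (int (i + k * l)) s) = D (fib (int i) s)" for i l s
  proof (induction l)
    case (Suc l)
    have e: "int (i + k * Suc l) = int k + int (i + k * l)" by simp
    have "fib (int (i + k * Suc l)) s = cis (shift (int k) (shift (int (i + k * l)) s))"
      unfolding fib_def shift_shift e ..
    then have "D (fib (int (i + k * Suc l)) s) = D (fib (int (i + k * l)) s)"
      unfolding fib_def using D(2) by simp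
    then show ?case using Suc by simp
  qed simp
  have zeros: "poly R x = 0" "poly S x = 0" if x: "x \<in> X" for x
  proof -
    obtain j where j: "x = fib (int j) t" using x by (auto simp: X_def)
    have x1: "norm x \<le> 1" by (simp add: j)
    have "B x = w" using B[of "shift (int j) t"] t cis_h_eq_iff[of "shift (int j) t" t]
      by (auto simp: j fib_def)
    then show "poly S x = 0" using S[OF x1] by simp
    have "D x = \<mu> (j mod k)"
      unfolding \<mu>_def j using D_per[of "j mod k" "j div k" t] by simp
    then show "poly R x = 0" using R[OF x1] k0 by auto
  qed
  have S0: "poly S 0 \<noteq> 0" using S[of 0] pq(3)[of 0] w B0 by auto
  have R0: "poly R 0 \<noteq> 0"
  proof -
    have "norm (D 0) < 1" by (rule norm_blaschke_less[OF D(1) m0]) simp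
    moreover have "norm (\<mu> i) = 1" for i unfolding \<mu>_def by (rule norm_blaschke_eq[OF D(1)]) simp
    ultimately have "D 0 \<noteq> \<mu> i" for i by (metis less_irrefl)
    then show ?thesis using R[of 0] PQ(3)[of 0] by simp
  qed
  \<comment> \<open>The weights make the difference vanish also at \<open>0\<close>, which is off
    the circle: with the fibre this is \<open>n + 1\<close> zeros for degree at most
    \<open>n\<close>.\<close>
  define T where "T = smult (poly S 0) R - smult (poly R 0) S"
  have T0: "T = 0"
  proof (rule ccontr)
    assume T: "T \<noteq> 0"
    have "insert 0 X \<subseteq> {x. poly T x = 0}" using zeros by (auto simp: T_def)
    then have "card (insert 0 X) \<le> degree T"
      using card_poly_roots_bound[OF T] poly_roots_finite[OF T] card_mono le_trans by blast
    moreover have "degree T \<le> n"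
      unfolding T_def using degR degS degree_smult_le le_trans by (intro degree_diff_le) blast+
    moreover have "norm x = 1" if "x \<in> X" for x using that by (auto simp: X_def)
    then have "0 \<notin> X" by fastforce
    moreover have "finite X" "card X = n" using inj by (simp_all add: X_def card_image)
    ultimately show False by simp
  qed
  have "poly S 0 * poly R z = poly R 0 * poly S z" for z
    using arg_cong[OF T0, of "\<lambda>p. poly p z"] by (simp add: T_def)
  then have "poly S 0 / poly R 0 * poly R z = poly S z" for z using R0 by (simp add: field_simps)
  then show ?thesis
    using R S R0 S0 by (intro that[of "poly S 0 / poly R 0" \<mu>]) (simp, metis mult.assoc)
qed

text \<open>The fibre identities over \<open>1\<close> and \<open>- 1\<close> express
  \<open>B - 1\<close> and \<open>B + 1\<close> as polynomials in \<open>D\<close> up to a common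
  factor, so \<open>B\<close> is a rational function \<open>C\<close> of \<open>D\<close>. Since
  \<open>D\<close> maps the closed disc and the circle onto themselves, \<open>C\<close> has no
  poles there and is unimodular on the circle.\<close>

lemma blaschke_left_factor:
  assumes Bl: "blaschke n B" and B: "\<And>t. B (cis t) = cis (h t)"
    and D: "blaschke m D" "\<And>t. D (cis (shift (int k) t)) = D (cis t)" and n: "n = k * m"
  obtains C where "blaschke k C" "\<And>z. norm z \<le> 1 \<Longrightarrow> B z = C (D z)"
proof -
  have m0: "m > 0" using n n_pos by auto
  obtain p q where pq: "degree p \<le> n" "degree q \<le> n" "\<And>z. norm z \<le> 1 \<Longrightarrow> poly q z \<noteq> 0"
    "\<And>z. norm z \<le> 1 \<Longrightarrow> B z * poly q z = poly p z" using blaschke_quotient_polys[OF Bl] by metis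
  obtain P Q where PQ: "degree P \<le> m" "degree Q \<le> m" "\<And>z. norm z \<le> 1 \<Longrightarrow> poly Q z \<noteq> 0"
    "\<And>z. norm z \<le> 1 \<Longrightarrow> D z * poly Q z = poly P z" using blaschke_quotient_polys[OF D(1)] by metis
  have B0: "norm (B 0) < 1" by (rule norm_blaschke_less[OF Bl n_pos]) simp
  obtain c \<mu> where c: "\<And>z. norm z \<le> 1 \<Longrightarrow> c * (\<Prod>i<k. D z - \<mu> i) * poly Q z ^ k = (B z - 1) * poly q z"
    using fibre_polynomial[OF B D n pq PQ, of 1] B0 by (metis norm_one)
  obtain c' \<nu> where c': "\<And>z. norm z \<le> 1 \<Longrightarrow> c' * (\<Prod>i<k. D z - \<nu> i) * poly Q z ^ k = (B z - (- 1)) * poly q z"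
    using fibre_polynomial[OF B D n pq PQ, of "- 1"] B0 by (metis norm_minus_cancel norm_one)
  define M where "M u = c * (\<Prod>i<k. u - \<mu> i)" for u
  define N where "N u = c' * (\<Prod>i<k. u - \<nu> i)" for u
  \<comment> \<open>For \<open>u = D z\<close>, the numerator and the denominator are
    \<open>2 * B z\<close> and \<open>2\<close>, each times
    \<open>poly q z / poly Q z ^ k\<close>.\<close>
  define C where "C u = (M u + N u) / (N u - M u)" for u
  have diff: "(N (D z) - M (D z)) * poly Q z ^ k = 2 * poly q z"
    and sum: "(M (D z) + N (D z)) * poly Q z ^ k = B z * (2 * poly q z)" if "norm z \<le> 1" for z
    using c[OF that] c'[OF that] unfolding M_def N_def by (simp_all add: algebra_simps)
  have nzD: "N (D z) - M (D z) \<noteq> 0" if "norm z \<le> 1" for z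
    using diff[OF that] pq(3)[OF that] by auto
  have CD: "C (D z) = B z" if "norm z \<le> 1" for z
  proof -
    have "(M (D z) + N (D z)) * poly Q z ^ k = B z * (N (D z) - M (D z)) * poly Q z ^ k"
      using diff[OF that] sum[OF that] by simp
    then have "M (D z) + N (D z) = B z * (N (D z) - M (D z))" using PQ(3)[OF that] by simp
    then show ?thesis using nzD[OF that] by (simp add: C_def)
  qed
  have "M \<in> disc_algebra" "N \<in> disc_algebra"
    unfolding M_def[abs_def] N_def[abs_def] by (intro disc_algebra_intros)+
  moreover have "N u - M u \<noteq> 0" if "norm u \<le> 1" for u
    using blaschke_surj[OF D(1) m0 that] nzD by metis
  ultimately have CA: "C \<in> disc_algebra"
    unfolding C_def[abs_def] by (intro disc_algebra_intros)
  have "norm (C u) = 1" if u: "norm u = 1" for u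
  proof -
    obtain z where "norm z = 1" "D z = u" using blaschke_surj[OF D(1) m0 eq_refl[OF u]] u by metis
    then show ?thesis using CD[of z] norm_blaschke_eq[OF Bl, of z] by simp
  qed
  from blaschke_of_unimodular[OF CA this] obtain d b
    where b: "blaschke d b" "\<And>z. norm z \<le> 1 \<Longrightarrow> C z = b z" by metis
  have Dle: "norm (D z) \<le> 1" if "norm z \<le> 1" for z
    by (rule disc_algebra_norm_le[OF blaschke_in_disc_algebra[OF D(1)] _ that])
       (simp add: norm_blaschke_eq[OF D(1)])
  have BbD: "B z = b (D z)" if "norm z \<le> 1" for z
    using b(2)[OF Dle[OF that]] CD[OF that] by simp
  obtain g where g: "continuous_on UNIV g" "\<And>t. b (cis t) = cis (g t)"
    "\<And>t. g (t + 2 * pi) = g t + 2 * pi * real d" using blaschke_lift[OF b(1)] by metis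
  obtain f where f: "continuous_on UNIV f" "\<And>t. D (cis t) = cis (f t)"
    "\<And>t. f (t + 2 * pi) = f t + 2 * pi * real m" using blaschke_lift[OF D(1)] by metis
  have g_per: "g (t + 2 * pi * real i) = g t + 2 * pi * (real d * real i)" for t i
  proof (induction i)
    case (Suc i)
    have "g (t + 2 * pi * real (Suc i)) = g (t + 2 * pi * real i + 2 * pi)" by (simp add: algebra_simps)
    then show ?case unfolding g(3) Suc by (simp add: algebra_simps)
  qed simp
  have "real n = real d * real m"
  proof (rule lift_degree_unique)
    show "continuous_on UNIV h" by (rule cont)
    show "continuous_on UNIV (\<lambda>t. g (f t))" by (rule continuous_on_compose2[OF g(1) f(1)]) simp
    show "cis (h t) = cis (g (f t))" for t
      using BbD[of "cis t"] by (simp add: B f(2) g(2))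
    show "h (t + 2 * pi) = h t + 2 * pi * real n" for t by (rule period)
    show "g (f (t + 2 * pi)) = g (f t) + 2 * pi * (real d * real m)" for t
      unfolding f(3) by (rule g_per)
  qed
  then have "d = k" using n m0 by (simp flip: of_nat_mult)
  then show ?thesis using that[of b] b BbD by simp
qed

end

section \<open>From tangency to the factorization\<close>

lemma blaschke_ident: "blaschke (Suc 0) (\<lambda>z. z)"
  unfolding blaschke_def by (intro exI[of _ 1] exI[of _ "\<lambda>_. 0"]) simp

lemma blaschke_power:
  assumes "norm \<gamma> = 1" shows "blaschke k (\<lambda>z. \<gamma> * z ^ k)"
  unfolding blaschke_def using assms by (intro exI[of _ \<gamma>] exI[of _ "\<lambda>_. 0"]) simp

lemma vieta_quadratic:
  fixes a b c x y :: "'a::field"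
  assumes "a * x\<^sup>2 - b * x + c = 0" "a * y\<^sup>2 - b * y + c = 0" "x \<noteq> y"
  shows "b = a * (x + y)" "c = a * (x * y)"
proof -
  have "(a * (x + y) - b) * (x - y) = (a * x\<^sup>2 - b * x + c) - (a * y\<^sup>2 - b * y + c)"
    by (simp add: algebra_simps power2_eq_square)
  then show b: "b = a * (x + y)" using assms by simp
  have "c = b * x - a * x\<^sup>2" using assms(1) by (simp add: algebra_simps eq_neg_iff_add_eq_0)
  then show "c = a * (x * y)" unfolding b by (simp add: algebra_simps power2_eq_square)
qed

context circle_lift
begin

text \<open>Both neighbours of a vertex satisfy the same tangency quadratic, because the tangency
  condition is symmetric in the ends of a side. For \<open>n \<ge> 3\<close> they are distinct, so
  Vieta's formulas apply.\<close>

lemma adjacent_vertices: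
  assumes n: "n \<ge> 3" and foci: "norm f1 < 1" "norm f2 < 1"
    and tan: "\<And>t. norm (fib 0 t + fib 1 t - cnj f1 * (fib 0 t * fib 1 t) - f2) = 2 * r"
  obtains f f' g where "\<And>t. quad f (cis t) = quad g (cis t) * (fib 1 t + fib (- 1) t)"
    "\<And>t. quad f' (cis t) = quad g (cis t) * (fib 1 t * fib (- 1) t)"
    "\<And>u. norm u \<le> 1 \<Longrightarrow> quad g u \<noteq> 0"
proof -
  \<comment> \<open>\<open>g\<close>, \<open>f\<close> and \<open>f'\<close> are the leading,
    negated middle and constant coefficients of the tangency quadratic, expanded in powers of the
    vertex.\<close>
  define g where "g = (1 :: complex, - (cnj f1 + cnj f2), cnj f1 * cnj f2)"
  define f where "f = (f1 + f2, 4 * (of_real r)\<^sup>2 - 2 - cnj f1 * f1 - cnj f2 * f2, cnj f1 + cnj f2)"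
  define f' where "f' = (f1 * f2, - (f1 + f2), 1 :: complex)"
  have g: "quad g u = (1 - cnj f1 * u) * (1 - cnj f2 * u)" for u
    by (simp add: g_def algebra_simps power2_eq_square)
  have f: "quad f u = 4 * (of_real r)\<^sup>2 * u - (1 - cnj f1 * u) * (u - f1) - (1 - cnj f2 * u) * (u - f2)" for u
    by (simp add: f_def algebra_simps power2_eq_square)
  have f': "quad f' u = (u - f1) * (u - f2)" for u
    by (simp add: f'_def algebra_simps power2_eq_square)
  have next_root: "quad g (fib 0 t) * (fib 1 t)\<^sup>2 - quad f (fib 0 t) * fib 1 t + quad f' (fib 0 t) = 0" for t
    unfolding f f' g by (rule tangent_chord_equation[OF _ _ tan]) simp_all
  have prev_root: "quad g (fib 0 t) * (fib (- 1) t)\<^sup>2 - quad f (fib 0 t) * fib (- 1) t + quad f' (fib 0 t) = 0" for t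
  proof -
    have "norm (fib 0 t + fib (- 1) t - cnj f1 * (fib 0 t * fib (- 1) t) - f2) = 2 * r"
      using tan[of "shift (- 1) t"] by (simp add: fib_shift ac_simps)
    then show ?thesis unfolding f f' g by (rule tangent_chord_equation[rotated 2]) simp_all
  qed
  have "fib 1 t \<noteq> fib (- 1) t" for t using n by (auto simp: fib_eq_iff dest: zdvd_imp_le)
  note v = vieta_quadratic[OF next_root prev_root this]
  have cis: "cis t = fib 0 t" for t by (simp add: fib_def)
  show ?thesis
  proof (rule that[of f g f'])
    show "quad g u \<noteq> 0" if "norm u \<le> 1" for u
      unfolding g using foci blaschke_denom_nz that by simp
  qed (unfold cis, (rule v)+)
qed

end

theorem theorem3p5:
  fixes B :: "complex \<Rightarrow> complex" and n k :: nat
  assumes "blaschke n B"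
    and "blaschke_curve_is_ellipse B"
    and "k dvd n" and "k > 1"
  shows "\<exists>C D. blaschke k C \<and> blaschke (n div k) D \<and>
           (\<forall>z\<in>ball 0 1. B z = C (D z))"
proof -
  consider "n = 0" | "n = k" | "n > 0" "n \<noteq> k" by blast
  then show ?thesis
  proof cases
    case 1
    then obtain \<gamma> where "norm \<gamma> = 1" "\<And>z. B z = \<gamma>"
      using assms(1) unfolding blaschke_def by auto
    \<comment> \<open>In degree zero \<open>B\<close> is constant: the inner factor is the constant
      \<open>1\<close>, at which \<open>\<gamma> * z ^ k\<close> takes the value
      \<open>\<gamma>\<close>.\<close>
    then show ?thesis using blaschke_power[of \<gamma> k] blaschke_power[of 1 0] 1
      by (intro exI[of _ "\<lambda>z. \<gamma> * z ^ k"] exI[of _ "\<lambda>z. 1 * z ^ 0"]) auto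
  next
    case 2
    then show ?thesis using assms(1,4) blaschke_ident
      by (intro exI[of _ B] exI[of _ "\<lambda>z. z"]) auto
  next
    case 3
    define m where "m = n div k"
    have n: "n = k * m" using assms(3) by (simp add: m_def)
    with 3 have "m \<noteq> 0" "m \<noteq> 1" by auto
    then have m: "m > 0" "m \<ge> 2" by auto
    \<comment> \<open>Two proper factors make the degree at least \<open>4\<close>, so the two
      neighbours of a vertex differ.\<close>
    have "k * m \<ge> 2 * 2" using assms(4) m by (intro mult_le_mono) auto
    then have n3: "n \<ge> 3" by (simp add: n)
    obtain h where h: "continuous_on UNIV h" "\<And>t. B (cis t) = cis (h t)"
      "\<And>t. h (t + 2 * pi) = h t + 2 * pi * real n" "strict_mono h"
      using blaschke_lift[OF assms(1)] 3 by metis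
    interpret circle_lift n h by unfold_locales (use h 3 in auto)
    obtain f1 f2 r where r: "dist f1 f2 < 2 * r"
      and E: "\<And>w. norm w = 1 \<Longrightarrow> inscribed_in_polygon (ellipse f1 f2 r) (blaschke_vertices B w)"
      using assms(2) unfolding blaschke_curve_is_ellipse_def is_ellipse_def by blast
    have foci: "norm f1 < 1" "norm f2 < 1" using ellipse_foci_in_disc[OF E[of 1] r] by simp_all
    have tan: "norm (fib 0 t + fib 1 t - cnj f1 * (fib 0 t * fib 1 t) - f2) = 2 * r" for t
      by (rule side_equation[OF h(2) _ r E]) (use n3 in auto)
    have ext: "\<exists>s p. extends_pair (int j) s p" for j
    proof (rule adjacent_vertices[OF n3 foci tan])
      fix f f' g
      assume "\<And>t. quad f (cis t) = quad g (cis t) * (fib 1 t + fib (- 1) t)"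
        "\<And>t. quad f' (cis t) = quad g (cis t) * (fib 1 t * fib (- 1) t)"
        "\<And>u. norm u \<le> 1 \<Longrightarrow> quad g u \<noteq> 0"
      then show ?thesis by (rule extends_pair_ex)
    qed
    obtain D where D: "blaschke m D" "\<And>t. D (cis (shift (int k) t)) = D (cis t)"
      using invariant_blaschke_ex[OF ext n m(1)] by metis
    obtain C where "blaschke k C" "\<And>z. norm z \<le> 1 \<Longrightarrow> B z = C (D z)"
      using blaschke_left_factor[OF assms(1) h(2) D n] by metis
    then show ?thesis using D(1) unfolding m_def by (intro exI[of _ C] exI[of _ D]) simp
  qed
qed

end
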